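(* A triangulation $\Gamma$ of a connected closed $2$-dimensional surface is $z$-knotted if and only if for every face $F$ of $\Gamma$ the $z$-monodromy $M_F$ is one of the following: (M1) the identity; (M2) $D_F$; (M3) $(-e_1,e_2,e_3)(-e_3,-e_2,e_1)$ where $(e_1,e_2,e_3)$ is one of the cycles of $D_F$; (M4) $(e_1,-e_2)(e_2,-e_1)$ where $(e_1,e_2,e_3)$ is one of the cycles of $D_F$ (with $e_3,-e_3$ fixed).
   Context: Let $\Gamma$ be a connected simple finite graph embedded in a connected closed $2$-dimensional surface such that every face (closure of a component of the complement) is a closed $2$-disc, every edge lies in exactly two distinct faces, two distinct faces meet in an edge, a vertex, or not at all, and every face has exactly three edges (a triangulation). Two distinct edges are adjacent if they share a vertex and lie in a common face. A zigzag is a sequence of edges $(e_i)_{i\in\mathbb N}$ with $e_i,e_{i+1}$ adjacent and the face containing $e_i,e_{i+1}$ distinct from the face containing $e_{i+1},e_{i+2}$, for all $i$; it is periodic and regarded as a cyclic sequence; written as a cyclic sequence of vertices, each passage through an edge has a direction (an oriented edge). A zigzag is determined by any two consecutive oriented edges; its reverse $Z^{-1}$ is also a zigzag. $\Gamma$ is $z$-knotted if it has exactly one pair of zigzags $\{Z,Z^{-1}\}$. For a face $F$ with vertices $a,b,c$, let $\Omega(F)=\{ab,bc,ca,ac,cb,ba\}$ be its oriented edges, $-e$ the reverse of $e$, and $D_F=(ab,bc,ca)(ac,cb,ba)$ (so $D_F(xy)=yz$ for distinct $x,y,z$). The $z$-monodromy $M_F:\Omega(F)\to\Omega(F)$: for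 $e\in\Omega(F)$ take $e_0$ with $D_F(e_0)=e$ and the zigzag $Z$ containing consecutive oriented edges $e_0,e$; $M_F(e)$ is the first element of $\Omega(F)$ occurring in $Z$ after $e$. *)

theory Defs
  imports "HOL-Analysis.Analysis" "HOL-Combinatorics.Cycles"
begin

section \<open>Graphs embedded in surfaces\<close>

definition closed_surface :: "'a topology \<Rightarrow> bool" where
  "closed_surface X \<longleftrightarrow>
     topspace X \<noteq> {} \<and> connected_space X \<and> compact_space X \<and>
     Hausdorff_space X \<and> second_countable X \<and>
     (\<forall>x\<in>topspace X. \<exists>U. openin X U \<and> x \<in> U \<and>
        subtopology X U homeomorphic_space (euclidean :: (real^2) topology))"

text \<open>
  The vertices are points of the surface, an edge is a two-element set of vertices, and
  \<open>curve G e\<close> is the subset of the surface that realises the edge \<open>e\<close>.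
\<close>

record 'a embedded_graph =
  surface :: "'a topology"
  verts :: "'a set"
  edges :: "'a set set"
  curve :: "'a set \<Rightarrow> 'a set"

definition simple_finite_graph :: "'a embedded_graph \<Rightarrow> bool" where
  "simple_finite_graph G \<longleftrightarrow>
     finite (verts G) \<and> (\<forall>e\<in>edges G. e \<subseteq> verts G \<and> card e = 2)"

definition connected_graph :: "'a embedded_graph \<Rightarrow> bool" where
  "connected_graph G \<longleftrightarrow> verts G \<noteq> {} \<and>
     (\<forall>x\<in>verts G. \<forall>y\<in>verts G. (x, y) \<in> {(u, w). {u, w} \<in> edges G}\<^sup>*)"

definition arc_in :: "'a topology \<Rightarrow> 'a set \<Rightarrow> 'a \<Rightarrow> 'a \<Rightarrow> bool" where
  "arc_in X A x y \<longleftrightarrow>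
     (\<exists>g. embedding_map (top_of_set {0..1::real}) X g \<and> g ` {0..1} = A \<and> g 0 = x \<and> g 1 = y)"

definition embedding_in_surface :: "'a embedded_graph \<Rightarrow> bool" where
  "embedding_in_surface G \<longleftrightarrow>
     verts G \<subseteq> topspace (surface G) \<and>
     (\<forall>x y. {x, y} \<in> edges G \<longrightarrow> arc_in (surface G) (curve G {x, y}) x y) \<and>
     (\<forall>e\<in>edges G. curve G e \<inter> verts G = e) \<and>
     (\<forall>e\<in>edges G. \<forall>e'\<in>edges G. e \<noteq> e' \<longrightarrow> curve G e \<inter> curve G e' = e \<inter> e')"

definition support :: "'a embedded_graph \<Rightarrow> 'a set" where
  "support G = verts G \<union> (\<Union>e\<in>edges G. curve G e)"

definition faces :: "'a embedded_graph \<Rightarrow> 'a set set" where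
  "faces G = {surface G closure_of C | C.
     C \<in> connected_components_of (subtopology (surface G) (topspace (surface G) - support G))}"

definition face_edges :: "'a embedded_graph \<Rightarrow> 'a set \<Rightarrow> 'a set set" where
  "face_edges G F = {e \<in> edges G. curve G e \<subseteq> F}"

definition surface_triangulation :: "'a embedded_graph \<Rightarrow> bool" where
  "surface_triangulation G \<longleftrightarrow>
     closed_surface (surface G) \<and>
     simple_finite_graph G \<and> connected_graph G \<and> embedding_in_surface G \<and>
     (\<forall>F\<in>faces G. subtopology (surface G) F homeomorphic_space
        top_of_set (cball (0::real^2) 1)) \<and>
     (\<forall>e\<in>edges G. card {F \<in> faces G. e \<in> face_edges G F} = 2) \<and>
     (\<forall>F\<in>faces G. \<forall>F'\<in>faces G. F \<noteq> F' \<longrightarrow>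
        (\<exists>e\<in>edges G. F \<inter> F' = curve G e) \<or> (\<exists>x\<in>verts G. F \<inter> F' = {x}) \<or> F \<inter> F' = {}) \<and>
     (\<forall>F\<in>faces G. card (face_edges G F) = 3)"

section \<open>Zigzags\<close>

definition adjacent :: "'a embedded_graph \<Rightarrow> 'a set \<Rightarrow> 'a set \<Rightarrow> bool" where
  "adjacent G e e' \<longleftrightarrow> e \<in> edges G \<and> e' \<in> edges G \<and> e \<noteq> e' \<and> e \<inter> e' \<noteq> {} \<and>
     (\<exists>F\<in>faces G. e \<in> face_edges G F \<and> e' \<in> face_edges G F)"

text \<open>
  A zigzag is given by the sequence \<open>v\<close> of the vertices it passes, so that its edges are
  \<open>{v i, v (Suc i)}\<close> and its oriented edges are \<open>(v i, v (Suc i))\<close>. Since the edges follow a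
  vertex sequence, three consecutive edges never meet in a common vertex. In a triangulation two
  adjacent edges lie in only one common face, which is the \<open>F\<close> (or \<open>F'\<close>) below.
\<close>

definition zigzag :: "'a embedded_graph \<Rightarrow> (nat \<Rightarrow> 'a) \<Rightarrow> bool" where
  "zigzag G v \<longleftrightarrow> (let e = (\<lambda>i. {v i, v (Suc i)}) in
     \<forall>i. adjacent G (e i) (e (Suc i)) \<and>
       (\<exists>F\<in>faces G. \<exists>F'\<in>faces G. F \<noteq> F' \<and>
          e i \<in> face_edges G F \<and> e (Suc i) \<in> face_edges G F \<and>
          e (Suc i) \<in> face_edges G F' \<and> e (Suc (Suc i)) \<in> face_edges G F'))"

text \<open>
  For a periodic sequence, \<open>cyclic_seq v\<close> is the cyclic sequence it determines, represented as the
  set of its shifts. The two definitions after it are meaningful for periodic sequences only;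
  zigzags are periodic because the graph is finite.
\<close>

definition cyclic_seq :: "(nat \<Rightarrow> 'a) \<Rightarrow> (nat \<Rightarrow> 'a) set" where
  "cyclic_seq v = {\<lambda>i. v (i + k) | k. True}"

definition period :: "(nat \<Rightarrow> 'a) \<Rightarrow> nat" where
  "period v = (LEAST n. n > 0 \<and> (\<forall>i. v (i + n) = v i))"

definition reversed :: "(nat \<Rightarrow> 'a) \<Rightarrow> nat \<Rightarrow> 'a" where
  "reversed v i = v (period v - i mod period v)"

definition z_knotted :: "'a embedded_graph \<Rightarrow> bool" where
  "z_knotted G \<longleftrightarrow>
     (\<exists>v. zigzag G v \<and>
        {cyclic_seq w | w. zigzag G w} = {cyclic_seq v, cyclic_seq (reversed v)})"

section \<open>The z-monodromy\<close>

definition oriented_edges :: "'a embedded_graph \<Rightarrow> 'a set \<Rightarrow> ('a \<times> 'a) set" where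
  "oriented_edges G F = {(x, y). {x, y} \<in> face_edges G F}"

definition face_rotation :: "'a embedded_graph \<Rightarrow> 'a set \<Rightarrow> 'a \<times> 'a \<Rightarrow> 'a \<times> 'a" where
  "face_rotation G F = (\<lambda>(x, y). (y, THE z. z \<in> verts G \<inter> F \<and> z \<noteq> x \<and> z \<noteq> y))"

text \<open>
  The zigzag is started at the oriented edge \<open>e\<^sub>0\<close>, so that \<open>e\<close> is its oriented edge of index 1.
\<close>

definition z_monodromy :: "'a embedded_graph \<Rightarrow> 'a set \<Rightarrow> 'a \<times> 'a \<Rightarrow> 'a \<times> 'a" where
  "z_monodromy G F e =
     (let e\<^sub>0 = (THE e\<^sub>0. e\<^sub>0 \<in> oriented_edges G F \<and> face_rotation G F e\<^sub>0 = e);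
          v = (THE v. zigzag G v \<and> (v 0, v 1) = e\<^sub>0 \<and> (v 1, v 2) = e);
          n = (LEAST n. n > 1 \<and> (v n, v (Suc n)) \<in> oriented_edges G F)
      in (v n, v (Suc n)))"

end

theory Submission
  imports Defs
begin

text \<open>
  A zigzag is an orbit of the injective map \<open>(x, y, z) \<mapsto> (y, z, w)\<close> on flags, that is, on ordered
  triangles \<open>xyz\<close>, where \<open>yzw\<close> is the other triangle at the edge \<open>yz\<close>. Identifying a flag of the
  face \<open>F\<close> with its second oriented edge, \<open>D\<^sub>F \<circ> M\<^sub>F\<close> is the first return map of this dynamics to the
  six flags of \<open>F\<close>. Reversal gives \<open>M\<^sub>F (- M\<^sub>F e) = - e\<close>, and \<open>M\<^sub>F e \<noteq> - e\<close> because no zigzag is its own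
  reverse, so \<open>e \<mapsto> - M\<^sub>F e\<close> is one of the 15 perfect matchings of \<open>\<Omega>(F)\<close>. If the triangulation is
  z-knotted, then \<open>D\<^sub>F \<circ> M\<^sub>F\<close> has no fixed point, since the zigzag of a fixed flag would meet neither the
  remaining four flags of \<open>F\<close> nor their reverses; exactly the eight matchings of types (M1)-(M4) have
  no such fixed point. Conversely, each of these types puts all flags of a face on one zigzag up to
  reversal. Consecutive flags of a zigzag lie in neighbouring faces, and any two faces are joined by a
  chain of neighbours because a connected surface stays connected when the vertices are removed.

  That the three edges of a face form a triangle rests on invariance of domain: the part of the
  graph in a face is exactly the boundary circle of the disc.
\<close>

section \<open>Locally planar spaces\<close>

definition locally_planar :: "'a topology \<Rightarrow> bool" where
  "locally_planar X \<longleftrightarrow> (\<forall>x\<in>topspace X. \<exists>U. openin X U \<and> x \<in> U \<and>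
     subtopology X U homeomorphic_space (euclidean :: (real^2) topology))"

lemma homeomorphic_imp_homeomorphic_space:
  assumes "S homeomorphic T"
  shows "top_of_set S homeomorphic_space top_of_set T"
proof -
  obtain f g where "homeomorphism S T f g"
    using assms homeomorphic_def by blast
  then have "homeomorphic_maps (top_of_set S) (top_of_set T) f g"
    unfolding homeomorphism_def homeomorphic_maps_def
    by (simp add: image_subset_iff_funcset[symmetric])
  then show ?thesis
    by (rule homeomorphic_maps_imp_homeomorphic_space)
qed

lemma planar_chart:
  assumes X: "locally_planar X" and W: "openin X W" and p: "p \<in> W"
  obtains U where "openin X U" "p \<in> U" "U \<subseteq> W"
    "subtopology X U homeomorphic_space (euclidean :: (real^2) topology)"
proof -
  have "p \<in> topspace X"
    using W p openin_subset by blast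
  then obtain U0 where U0: "openin X U0" "p \<in> U0"
    and h0: "subtopology X U0 homeomorphic_space (euclidean :: (real^2) topology)"
    using X unfolding locally_planar_def by blast
  obtain h g where h: "homeomorphic_map (subtopology X U0) (euclidean :: (real^2) topology) h"
    and g: "homeomorphic_map euclidean (subtopology X U0) g"
    and gh: "\<And>x. x \<in> topspace (subtopology X U0) \<Longrightarrow> g (h x) = x"
    by (rule homeomorphic_space_unfold[OF h0]) blast
  have sub: "U0 \<subseteq> topspace X" using U0 openin_subset by blast
  have "openin (subtopology X U0) (W \<inter> U0)"
    using W by (simp add: openin_subtopology_Int)
  then have "open (h ` (W \<inter> U0))"
    using homeomorphic_map_openness_eq[OF h] by auto
  then obtain r where r: "r > 0" "ball (h p) r \<subseteq> h ` (W \<inter> U0)"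
    using p U0 unfolding open_contains_ball by blast
  let ?B = "ball (h p) r"
  let ?U = "g ` ?B"
  have "openin (subtopology X U0) ?U"
    using homeomorphic_map_openness_eq[OF g, of ?B] by auto
  then have "openin X ?U" using U0 openin_trans_full by blast
  moreover have "p \<in> ?U"
  proof -
    have "g (h p) = p" using gh[of p] U0 sub by auto
    moreover have "h p \<in> ?B" using r by simp
    ultimately show ?thesis by (metis imageI)
  qed
  moreover have UW: "?U \<subseteq> W \<inter> U0"
  proof -
    have "?U \<subseteq> g ` h ` (W \<inter> U0)" using r by (intro image_mono)
    also have "\<dots> \<subseteq> W \<inter> U0" using gh sub by auto
    finally show ?thesis .
  qed
  moreover have "subtopology X ?U homeomorphic_space (euclidean :: (real^2) topology)"
  proof -
    have "homeomorphic_map (subtopology euclidean ?B) (subtopology (subtopology X U0) ?U) g"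
      using g UW sub by (intro homeomorphic_map_subtopologies) auto
    moreover have "subtopology (subtopology X U0) ?U = subtopology X ?U"
      using UW by (simp add: subtopology_subtopology inf.absorb2)
    ultimately have "subtopology X ?U homeomorphic_space top_of_set ?B"
      using homeomorphic_map_imp_homeomorphic_space homeomorphic_space_sym by metis
    also have "top_of_set ?B homeomorphic_space top_of_set (UNIV :: (real^2) set)"
      using homeomorphic_ball_UNIV r by (blast intro: homeomorphic_imp_homeomorphic_space)
    finally show ?thesis by simp
  qed
  ultimately show ?thesis using that by blast
qed

lemma locally_planar_invariance_of_domain:
  fixes g :: "real^2 \<Rightarrow> 'a"
  assumes X: "locally_planar X" and S: "open S"
    and g: "continuous_map (top_of_set S) X g" "inj_on g S"
  shows "openin X (g ` S)"
proof (subst openin_subopen, intro ballI)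
  fix p assume "p \<in> g ` S"
  then obtain s where s: "s \<in> S" "p = g s" by blast
  have "p \<in> topspace X" using g s by (metis continuous_map_image_subset_topspace image_subset_iff topspace_euclidean_subtopology)
  then obtain U where U: "openin X U" "p \<in> U"
    and h0: "subtopology X U homeomorphic_space (euclidean :: (real^2) topology)"
    using X unfolding locally_planar_def by blast
  then obtain h where h: "homeomorphic_map (subtopology X U) (euclidean :: (real^2) topology) h"
    using homeomorphic_space by blast
  have sub: "U \<subseteq> topspace X" using U openin_subset by blast
  define S' where "S' = {x \<in> S. g x \<in> U}"
  have "openin (top_of_set S) S'"
    using openin_continuous_map_preimage[OF g(1) U(1)] unfolding S'_def by simp
  then have S': "open S'" using openin_open_eq[OF S] by simp
  have gU: "continuous_map (top_of_set S') (subtopology X U) g"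
  proof -
    have "continuous_map (subtopology (top_of_set S) S') X g"
      using g(1) continuous_map_from_subtopology by blast
    moreover have "subtopology (top_of_set S) S' = top_of_set S'"
      by (simp add: subtopology_subtopology S'_def Collect_conj_eq)
    ultimately show ?thesis by (auto simp: continuous_map_in_subtopology S'_def)
  qed
  have "continuous_map (top_of_set S') euclidean (h \<circ> g)"
    using continuous_map_compose[OF gU] h homeomorphic_imp_continuous_map by blast
  then have "continuous_on S' (h \<circ> g)" by simp
  moreover have injh: "inj_on h U"
    using homeomorphic_imp_injective_map[OF h] sub by (simp add: Int_absorb1)
  moreover have gs: "g ` S' \<subseteq> U" by (auto simp: S'_def)
  ultimately have "open ((h \<circ> g) ` S')"
    using S' comp_inj_on[OF inj_on_subset[OF g(2)] inj_on_subset[OF injh gs]]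
    by (intro invariance_of_domain) (auto simp: S'_def)
  then have "openin (subtopology X U) (g ` S')"
    using homeomorphic_map_openness[OF h, of "g ` S'"] gs sub by (simp add: image_comp)
  then have "openin X (g ` S')" using U openin_trans_full by blast
  then show "\<exists>T. openin X T \<and> p \<in> T \<and> T \<subseteq> g ` S"
    using s U by (intro exI[of _ "g ` S'"]) (auto simp: S'_def)
qed

lemma connected_sphere_minus_point:
  fixes a :: "real^2"
  assumes "r > 0"
  shows "connected (sphere a r - {b})"
proof (cases "b \<in> sphere a r")
  case True
  then have "(sphere a r - {b}) homeomorphic {x :: real^2. axis 1 1 \<bullet> x = 0}"
    using assms by (intro homeomorphic_punctured_sphere_hyperplane) auto
  moreover have "connected {x :: real^2. axis 1 1 \<bullet> x = 0}"
    by (simp add: convex_connected convex_hyperplane)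
  ultimately show ?thesis using homeomorphic_connectedness by blast
next
  case False
  then show ?thesis using connected_sphere[of a r] by simp
qed

lemma disc_boundary_minus_point_connected:
  assumes X: "locally_planar X" and sub: "F \<subseteq> topspace X"
    and F: "subtopology X F homeomorphic_space top_of_set (cball (0::real^2) 1)"
  shows "connectedin X (F - X interior_of F - {y})" "connectedin X (F - X interior_of F)"
proof -
  obtain k l where k: "homeomorphic_map (subtopology X F) (top_of_set (cball (0::real^2) 1)) k"
    and l: "homeomorphic_map (top_of_set (cball (0::real^2) 1)) (subtopology X F) l"
    and "\<And>x. x \<in> topspace (subtopology X F) \<Longrightarrow> l (k x) = x"
    and "\<And>y. y \<in> topspace (top_of_set (cball (0::real^2) 1)) \<Longrightarrow> k (l y) = y"
    by (rule homeomorphic_space_unfold[OF F]) blast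
  then have lk: "\<And>x. x \<in> F \<Longrightarrow> l (k x) = x" and kl: "\<And>y. y \<in> cball 0 1 \<Longrightarrow> k (l y) = y"
    using sub by auto
  have kF: "k ` F = cball 0 1"
    using homeomorphic_imp_surjective_map[OF k] sub by (simp add: Int_absorb1)
  have injl: "inj_on l (cball 0 1)" using kl by (rule inj_on_inverseI)
  have lF: "l ` cball 0 1 = F"
    using homeomorphic_imp_surjective_map[OF l] sub by (simp add: Int_absorb1)
  have contl: "continuous_map (top_of_set (cball 0 1)) X l"
    using homeomorphic_imp_continuous_map[OF l] continuous_map_in_subtopology by blast
  have "openin X (l ` ball 0 1)"
  proof (rule locally_planar_invariance_of_domain[OF X])
    show "continuous_map (top_of_set (ball 0 1)) X l"
      using continuous_map_from_subtopology_mono[OF contl] ball_subset_cball by blast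
    show "inj_on l (ball 0 1)" using injl inj_on_subset ball_subset_cball by blast
  qed auto
  then have 1: "l ` ball 0 1 \<subseteq> X interior_of F"
    using lF ball_subset_cball by (metis image_mono interior_of_maximal)
  have 2: "X interior_of F \<subseteq> l ` ball 0 1"
  proof
    fix p assume p: "p \<in> X interior_of F"
    obtain U where U: "openin X U" "p \<in> U" "U \<subseteq> X interior_of F"
      and h0: "subtopology X U homeomorphic_space (euclidean :: (real^2) topology)"
      using planar_chart[OF X openin_interior_of p] by blast
    have UF: "U \<subseteq> F" by (rule order_trans[OF U(3) interior_of_subset])
    obtain g where g: "homeomorphic_map (euclidean :: (real^2) topology) (subtopology X U) g"
      using h0 homeomorphic_space homeomorphic_space_sym by blast
    have gU: "range g = U"
      using homeomorphic_imp_surjective_map[OF g] UF sub by auto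
    have "continuous_map euclidean (subtopology X F) g"
      using homeomorphic_imp_continuous_map[OF g] gU UF by (auto simp: continuous_map_in_subtopology)
    then have "continuous_map euclidean (top_of_set (cball (0::real^2) 1)) (k \<circ> g)"
      using continuous_map_compose homeomorphic_imp_continuous_map[OF k] by blast
    then have "continuous_on UNIV (k \<circ> g)" by (simp add: continuous_map_in_subtopology)
    moreover have "inj (k \<circ> g)"
      using homeomorphic_imp_injective_map[OF g] lk gU UF unfolding inj_def by (metis comp_apply rangeI subsetD UNIV_I injD topspace_euclidean)
    ultimately have "open (range (k \<circ> g))"
      by (intro invariance_of_domain) auto
    then have op: "open (k ` U)" using gU by (metis image_comp)
    have "k ` U \<subseteq> cball 0 1" using UF kF by blast
    then have "k ` U \<subseteq> ball 0 1" using op interior_maximal interior_cball by metis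
    then have "k p \<in> ball 0 1" "l (k p) = p" using U UF lk by auto
    then show "p \<in> l ` ball 0 1" by force
  qed
  have S: "F - X interior_of F = l ` sphere 0 1"
  proof -
    have "F - X interior_of F = l ` cball 0 1 - l ` ball 0 1" using 1 2 lF by blast
    also have "\<dots> = l ` (cball 0 1 - ball 0 1)"
      using injl by (simp add: inj_on_image_set_diff[of l "cball 0 1"] ball_subset_cball)
    finally show ?thesis by (simp add: cball_diff_eq_sphere)
  qed
  have *: "connectedin X (l ` T)" if "connected T" "T \<subseteq> sphere 0 1" for T
  proof -
    have "T \<subseteq> cball 0 1" using that sphere_cball by blast
    then have "continuous_map (top_of_set T) X l"
      using contl continuous_map_from_subtopology_mono by blast
    then show ?thesis
      using that connectedin_continuous_map_image[of "top_of_set T" X l T] by (simp add: connectedin_subtopology)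
  qed
  then show "connectedin X (F - X interior_of F)"
    unfolding S by (intro *) (auto intro: connected_sphere)
  have "F - X interior_of F - {y} = l ` (sphere 0 1 - {k y})" if "y \<in> F"
  proof -
    have "l ` (sphere 0 1 - {k y}) = l ` sphere 0 1 - l ` {k y}"
      using injl that kF by (intro inj_on_image_set_diff[of l "cball 0 1"]) auto
    then show ?thesis using S lk that by auto
  qed
  moreover have "F - X interior_of F - {y} = F - X interior_of F" if "y \<notin> F" using that by blast
  ultimately show "connectedin X (F - X interior_of F - {y})"
    using * connected_sphere_minus_point[of 1 0 "k y"] \<open>connectedin X (F - X interior_of F)\<close>
    by (cases "y \<in> F") (auto simp: S)
qed

lemma locally_planar_open_finite:
  assumes X: "locally_planar X" and U: "openin X U" and fin: "finite U"
  shows "U = {}"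
proof (rule ccontr)
  assume "U \<noteq> {}"
  then obtain p where "p \<in> U" by blast
  then obtain W where W: "openin X W" "W \<subseteq> U"
    and h: "subtopology X W homeomorphic_space (euclidean :: (real^2) topology)"
    using planar_chart[OF X U] by blast
  obtain g where g: "homeomorphic_map (euclidean :: (real^2) topology) (subtopology X W) g"
    using h homeomorphic_space homeomorphic_space_sym by blast
  have "inj g" using homeomorphic_imp_injective_map[OF g] by simp
  moreover have "range g \<subseteq> W" using homeomorphic_imp_surjective_map[OF g] by auto
  ultimately have "finite (UNIV :: (real^2) set)"
    using fin W finite_subset finite_imageD by metis
  then have "bounded (UNIV :: (real^2) set)" by (rule finite_imp_bounded)
  then show False using not_bounded_UNIV by blast
qed

lemma locally_planar_connected_minus_finite:
  assumes X: "locally_planar X" and conn: "connected_space X" and V: "finite V"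
    and A: "openin X A" and B: "openin X B" and cov: "A \<union> B = topspace X - V" and disj: "A \<inter> B = {}"
  shows "A = {} \<or> B = {}"
proof -
  have chart: "\<exists>U. openin X U \<and> p \<in> U \<and> (U - V \<subseteq> A \<or> U - V \<subseteq> B)" if p: "p \<in> topspace X" for p
  proof -
    obtain U where U: "openin X U" "p \<in> U"
      and h: "subtopology X U homeomorphic_space (euclidean :: (real^2) topology)"
      using X p unfolding locally_planar_def by blast
    have sub: "U \<subseteq> topspace X" using U openin_subset by blast
    obtain g where g: "homeomorphic_map (euclidean :: (real^2) topology) (subtopology X U) g"
      using h homeomorphic_space homeomorphic_space_sym by blast
    have gU: "range g = U" using homeomorphic_imp_surjective_map[OF g] sub by auto
    have "inj g" using homeomorphic_imp_injective_map[OF g] by simp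
    then have fin: "finite (g -` V)" using V by (simp add: finite_vimageI)
    have "connected (UNIV - g -` V)"
      using path_connected_complement_countable[of "g -` V"] fin
      by (simp add: Compl_eq_Diff_UNIV countable_finite path_connected_imp_connected)
    moreover have "continuous_map euclidean X g"
      using homeomorphic_imp_continuous_map[OF g] continuous_map_in_subtopology by blast
    ultimately have "connectedin X (g ` (UNIV - g -` V))"
      using connectedin_continuous_map_image by (metis connectedin_iff_connected)
    moreover have "g ` (UNIV - g -` V) = U - V" using gU by auto
    ultimately have c: "connectedin X (U - V)" by simp
    have "U - V \<subseteq> A \<union> B" using sub cov by blast
    then have "U - V \<subseteq> A \<or> U - V \<subseteq> B"
      using c A B disj unfolding connectedin by blast
    then show ?thesis using U by blast
  qed
  define A' where "A' = \<Union>{U. openin X U \<and> U - V \<subseteq> A}"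
  define B' where "B' = \<Union>{U. openin X U \<and> U - V \<subseteq> B}"
  have op: "openin X A'" "openin X B'" unfolding A'_def B'_def by auto
  have cover: "topspace X \<subseteq> A' \<union> B'"
  proof
    fix p assume "p \<in> topspace X"
    then obtain U where U: "openin X U" "p \<in> U" "U - V \<subseteq> A \<or> U - V \<subseteq> B"
      using chart by blast
    from U(3) show "p \<in> A' \<union> B'"
    proof
      assume "U - V \<subseteq> A"
      then show ?thesis using U(1,2) unfolding A'_def by blast
    next
      assume "U - V \<subseteq> B"
      then show ?thesis using U(1,2) unfolding B'_def by blast
    qed
  qed
  have "A' \<inter> B' \<subseteq> V" using disj unfolding A'_def B'_def by blast
  then have "A' \<inter> B' = {}"
    using locally_planar_open_finite[OF X openin_Int[OF op]] V finite_subset by blast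
  then have "A' = {} \<or> B' = {}"
    using conn op cover unfolding connected_space_def by blast
  moreover have "A \<subseteq> A'" "B \<subseteq> B'" using A B unfolding A'_def B'_def by blast+
  ultimately show ?thesis by blast
qed

section \<open>Faces of a triangulation\<close>

locale triangulation =
  fixes G :: "'a embedded_graph"
  assumes triangulation: "surface_triangulation G"
begin

abbreviation (input) "X \<equiv> surface G"

lemma planar: "locally_planar X"
  and connected_surface: "connected_space X"
  and Hausdorff_surface: "Hausdorff_space X"
  and surface_nonempty: "topspace X \<noteq> {}"
  using triangulation
  unfolding surface_triangulation_def closed_surface_def locally_planar_def by auto

lemma finite_verts: "finite (verts G)"
  and edge_subset: "e \<in> edges G \<Longrightarrow> e \<subseteq> verts G"
  and card_edge: "e \<in> edges G \<Longrightarrow> card e = 2"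
  using triangulation
  unfolding surface_triangulation_def simple_finite_graph_def by auto

lemma verts_subset: "verts G \<subseteq> topspace X"
  and curve_verts: "e \<in> edges G \<Longrightarrow> curve G e \<inter> verts G = e"
  and curve_Int: "e \<in> edges G \<Longrightarrow> e' \<in> edges G \<Longrightarrow> e \<noteq> e' \<Longrightarrow> curve G e \<inter> curve G e' = e \<inter> e'"
  and curve_arc: "{x, y} \<in> edges G \<Longrightarrow> arc_in X (curve G {x, y}) x y"
  using triangulation
  unfolding surface_triangulation_def embedding_in_surface_def by auto

lemma face_disc: "F \<in> faces G \<Longrightarrow>
    subtopology X F homeomorphic_space top_of_set (cball (0::real^2) 1)"
  and edge_two_faces: "e \<in> edges G \<Longrightarrow> card {F \<in> faces G. e \<in> face_edges G F} = 2"
  and card_face_edges: "F \<in> faces G \<Longrightarrow> card (face_edges G F) = 3"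
  using triangulation unfolding surface_triangulation_def by auto

lemma faces_Int: "F \<in> faces G \<Longrightarrow> F' \<in> faces G \<Longrightarrow> F \<noteq> F' \<Longrightarrow>
    (\<exists>e\<in>edges G. F \<inter> F' = curve G e) \<or> (\<exists>x\<in>verts G. F \<inter> F' = {x}) \<or> F \<inter> F' = {}"
  using triangulation unfolding surface_triangulation_def by blast

lemma finite_edges: "finite (edges G)"
proof (rule finite_subset)
  show "edges G \<subseteq> Pow (verts G)" using edge_subset by blast
qed (simp add: finite_verts)

lemma edge_pair:
  assumes "e \<in> edges G"
  obtains x y where "e = {x, y}" "x \<noteq> y"
  using card_edge[OF assms] by (auto simp: card_2_iff)

lemma curve_subset: "e \<in> edges G \<Longrightarrow> e \<subseteq> curve G e"
  using curve_verts by blast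

lemma closedin_curve:
  assumes "e \<in> edges G"
  shows "closedin X (curve G e)"
proof -
  obtain x y where e: "e = {x, y}" using edge_pair[OF assms] .
  obtain g where g: "embedding_map (top_of_set {0..1::real}) X g" "g ` {0..1} = curve G e"
    using curve_arc[of x y] assms e unfolding arc_in_def by auto
  have "continuous_map (top_of_set {0..1::real}) X g"
    using homeomorphic_imp_continuous_map[OF g(1)[unfolded embedding_map_def]]
    by (simp add: continuous_map_in_subtopology)
  moreover have "compactin (top_of_set {0..1::real}) {0..1}"
    by (simp add: compactin_subtopology)
  ultimately have "compactin X (curve G e)"
    using g(2) image_compactin by metis
  then show ?thesis using Hausdorff_surface compactin_imp_closedin by blast
qed

lemma infinite_curve:
  assumes "e \<in> edges G"
  shows "infinite (curve G e)"
proof -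
  obtain x y where e: "e = {x, y}" using edge_pair[OF assms] .
  obtain g where g: "embedding_map (top_of_set {0..1::real}) X g" "g ` {0..1} = curve G e"
    using curve_arc[of x y] assms e unfolding arc_in_def by auto
  have "inj_on g {0..1}"
    using g(1) unfolding embedding_map_def by (metis homeomorphic_imp_injective_map topspace_euclidean_subtopology)
  then show ?thesis using g(2) infinite_Icc[of "0::real" 1] finite_image_iff by (metis zero_less_one)
qed

lemma closedin_support: "closedin X (support G)"
  unfolding support_def using finite_edges finite_verts verts_subset closedin_curve Hausdorff_surface
  by (intro closedin_Un closedin_Union) (auto intro: closedin_Hausdorff_finite)

definition complement :: "'a topology" where
  "complement = subtopology X (topspace X - support G)"

lemma faces_eq: "faces G = (\<lambda>C. X closure_of C) ` connected_components_of complement"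
  unfolding faces_def complement_def by auto

lemma topspace_complement: "topspace complement = topspace X - support G"
  unfolding complement_def by auto

lemma openin_component:
  assumes C: "C \<in> connected_components_of complement"
  shows "openin X C"
proof (subst openin_subopen, intro ballI)
  fix p assume p: "p \<in> C"
  have op: "openin X (topspace X - support G)" using closedin_support by blast
  have "p \<in> topspace X - support G"
    using p C connected_components_of_subset topspace_complement by blast
  then obtain U where U: "openin X U" "p \<in> U" "U \<subseteq> topspace X - support G"
    and h: "subtopology X U homeomorphic_space (euclidean :: (real^2) topology)"
    using planar_chart[OF planar op] by blast
  have "connected_space (subtopology X U)"
    using h homeomorphic_connected_space connected_space_subconnected connectedin_absolute
    by (metis connected_UNIV connectedin_iff_connected connectedin_topspace topspace_euclidean)
  then have "connectedin X U" using U openin_subset by (auto simp: connectedin_def)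
  then have "connectedin complement U"
    using U(3) by (simp add: complement_def connectedin_subtopology)
  then have "U \<subseteq> C" using connected_components_of_maximal[OF C] p U(2) by (auto simp: disjnt_def)
  then show "\<exists>T. openin X T \<and> p \<in> T \<and> T \<subseteq> C" using U by blast
qed

lemma components_disjoint:
  assumes "C \<in> connected_components_of complement" "C' \<in> connected_components_of complement"
    and "C \<inter> C' \<noteq> {}"
  shows "C = C'"
  using assms pairwise_disjoint_connected_components_of[of complement]
  by (auto simp: pairwise_def disjnt_def)

lemma open_meets_closure: "openin X U \<Longrightarrow> p \<in> U \<Longrightarrow> p \<in> X closure_of C \<Longrightarrow> U \<inter> C \<noteq> {}"
  by (auto simp: in_closure_of)

lemma face_subset: "F \<in> faces G \<Longrightarrow> F \<subseteq> topspace X"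
  unfolding faces_eq by (auto dest: closure_of_subset_topspace[THEN subsetD])

lemma closedin_face: "F \<in> faces G \<Longrightarrow> closedin X F"
  unfolding faces_eq by auto

lemma edge_in_other_face:
  assumes "e \<in> edges G"
  obtains F' where "F' \<in> faces G" "e \<in> face_edges G F'" "F' \<noteq> F"
proof -
  have "card {F \<in> faces G. e \<in> face_edges G F} = 2" using edge_two_faces[OF assms] .
  then obtain A B where "A \<noteq> B" "{F \<in> faces G. e \<in> face_edges G F} = {A, B}"
    by (auto simp: card_2_iff)
  then show ?thesis using that by (metis (mono_tags, lifting) insertCI mem_Collect_eq)
qed

lemma component_in_face:
  assumes "x \<in> topspace X - support G"
  obtains C where "C \<in> connected_components_of complement" "x \<in> C" "X closure_of C \<in> faces G"
    "C \<subseteq> X closure_of C"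
proof -
  obtain C where C: "C \<in> connected_components_of complement" "x \<in> C"
    using assms topspace_complement Union_connected_components_of[of complement] by blast
  have "C \<subseteq> topspace X"
    using C(1) connected_components_of_subset topspace_complement by blast
  then show ?thesis using that C by (auto simp: faces_eq closure_of_subset)
qed

lemma graph_connected:
  "x \<in> verts G \<Longrightarrow> y \<in> verts G \<Longrightarrow> (x, y) \<in> {(u, w). {u, w} \<in> edges G}\<^sup>*"
  and verts_nonempty: "verts G \<noteq> {}"
  using triangulation unfolding surface_triangulation_def connected_graph_def by auto

lemma vertex_in_edge:
  assumes v: "v \<in> verts G"
  obtains e where "e \<in> edges G" "v \<in> e"
proof (cases "\<exists>e\<in>edges G. v \<in> e")
  case True
  then show ?thesis using that by blast
next
  case False
  have "w = v" if "w \<in> verts G" for w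
  proof -
    have "(v, w) \<in> {(u, w). {u, w} \<in> edges G}\<^sup>*"
      using graph_connected v that by blast
    then show ?thesis using False by (cases rule: converse_rtranclE) auto
  qed
  then have "verts G = {v}" using v by blast
  have "edges G = {}"
  proof (rule equals0I)
    fix e assume e: "e \<in> edges G"
    then have "e \<subseteq> {v}" using edge_subset \<open>verts G = {v}\<close> by metis
    then have "card e \<le> card {v}" by (intro card_mono) auto
    then show False using card_edge[OF e] by simp
  qed
  then have "finite (support G)" "support G \<subseteq> topspace X"
    using finite_verts verts_subset by (auto simp: support_def)
  moreover have "infinite (topspace X)"
    using locally_planar_open_finite[OF planar, of "topspace X"] surface_nonempty by auto
  ultimately obtain x where "x \<in> topspace X - support G"
    by (metis finite_Diff2 finite.emptyI all_not_in_conv)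
  then obtain F where "F \<in> faces G" using component_in_face[of x] by blast
  then have "face_edges G F \<noteq> {}" using card_face_edges by fastforce
  then show ?thesis using \<open>edges G = {}\<close> by (auto simp: face_edges_def)
qed

lemma support_eq: "support G = (\<Union>e\<in>edges G. curve G e)"
proof -
  have "verts G \<subseteq> (\<Union>e\<in>edges G. curve G e)"
  proof
    fix v assume "v \<in> verts G"
    then obtain e where e: "e \<in> edges G" "v \<in> e" by (rule vertex_in_edge)
    then show "v \<in> (\<Union>e\<in>edges G. curve G e)" using curve_subset[OF e(1)] by blast
  qed
  then show ?thesis unfolding support_def by blast
qed

lemma interior_face_support:
  assumes F: "F \<in> faces G"
  shows "X interior_of F \<inter> support G = {}"
proof (rule ccontr)
  assume "X interior_of F \<inter> support G \<noteq> {}"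
  then obtain p e where p: "p \<in> X interior_of F" and e: "e \<in> edges G" "p \<in> curve G e"
    unfolding support_eq by blast
  obtain F' where F': "F' \<in> faces G" "e \<in> face_edges G F'" "F' \<noteq> F"
    using edge_in_other_face[OF e(1)] .
  obtain C where C: "C \<in> connected_components_of complement" "F = X closure_of C"
    using F unfolding faces_eq by blast
  obtain C' where C': "C' \<in> connected_components_of complement" "F' = X closure_of C'"
    using F' unfolding faces_eq by blast
  have "p \<in> F'" using F' e by (auto simp: face_edges_def)
  then obtain q where q: "q \<in> X interior_of F" "q \<in> C'"
    using open_meets_closure[OF openin_interior_of p] C'(2) by blast
  then have "q \<in> F" using interior_of_subset by (metis subsetD)
  then have "C' \<inter> C \<noteq> {}"
    using open_meets_closure[OF openin_component[OF C'(1)] q(2)] C(2) by blast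
  then have "C = C'" using components_disjoint C(1) C'(1) by blast
  then show False using F' C C' by blast
qed

lemma face_Int_support:
  assumes F: "F \<in> faces G"
  shows "F \<inter> support G = F - X interior_of F"
proof
  show "F \<inter> support G \<subseteq> F - X interior_of F" using interior_face_support[OF F] by blast
  show "F - X interior_of F \<subseteq> F \<inter> support G"
  proof
    fix p assume p: "p \<in> F - X interior_of F"
    obtain C where C: "C \<in> connected_components_of complement" "F = X closure_of C"
      using F unfolding faces_eq by blast
    show "p \<in> F \<inter> support G"
    proof (rule ccontr)
      assume "p \<notin> F \<inter> support G"
      then have "p \<in> topspace X - support G" using p face_subset[OF F] by blast
      then obtain C' where C': "C' \<in> connected_components_of complement" "p \<in> C'"
        "C' \<subseteq> X closure_of C'"
        using component_in_face[of p] by blast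
      then have "C' \<inter> C \<noteq> {}"
        using open_meets_closure[OF openin_component[OF C'(1)] C'(2)] C(2) p by blast
      then have "C = C'" using components_disjoint C(1) C'(1) by blast
      then have "p \<in> X interior_of F"
        using interior_of_maximal[of C F X] openin_component[OF C(1)] C(2) C' by blast
      then show False using p by blast
    qed
  qed
qed

lemma connected_face_boundary:
  assumes "F \<in> faces G"
  shows "connectedin X (F \<inter> support G)" "connectedin X (F \<inter> support G - {y})"
  using disc_boundary_minus_point_connected[OF planar face_subset[OF assms] face_disc[OF assms]]
  by (simp_all add: face_Int_support[OF assms])

lemma inner_curve_point:
  assumes F: "F \<in> faces G" and e: "e \<in> edges G" and p: "p \<in> curve G e" "p \<in> F" "p \<notin> verts G"
  shows "e \<in> face_edges G F"
proof -
  obtain F' where F': "F' \<in> faces G" "e \<in> face_edges G F'" "F' \<noteq> F"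
    using edge_in_other_face[OF e] .
  then have "p \<in> F \<inter> F'" using p by (auto simp: face_edges_def)
  moreover from this p obtain e' where e': "e' \<in> edges G" "F \<inter> F' = curve G e'"
    using faces_Int[OF F F'(1)] F'(3) by (metis empty_iff singletonD)
  ultimately have "e = e'" using curve_Int[OF e e'(1)] p edge_subset[OF e] by blast
  then show ?thesis using e' e by (auto simp: face_edges_def)
qed

lemma connectedin_closed_cover:
  assumes "connectedin Y S" "closedin Y A" "closedin Y B" "S \<subseteq> A \<union> B" "A \<inter> B \<inter> S = {}"
  shows "A \<inter> S = {} \<or> B \<inter> S = {}"
  using assms unfolding connectedin_closedin by blast

lemma face_edge_nonvertex:
  assumes "e \<in> edges G"
  obtains p where "p \<in> curve G e" "p \<notin> verts G"
proof -
  have "\<not> curve G e \<subseteq> verts G"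
    using infinite_curve[OF assms] finite_subset[OF _ finite_verts] by metis
  then show ?thesis using that by blast
qed

lemma finite_face_edges: "finite (face_edges G F)"
  using finite_edges by (simp add: face_edges_def)

lemma face_boundary_eq:
  assumes F: "F \<in> faces G"
  shows "F \<inter> support G = (\<Union>e\<in>face_edges G F. curve G e)" (is "?S = ?A")
proof -
  let ?L = "?S - ?A"
  have sub: "?L \<subseteq> verts G"
    using inner_curve_point[OF F] by (auto simp: support_eq)
  have "finite ?L" using sub finite_verts finite_subset by blast
  then have cl: "closedin X ?L"
    using sub verts_subset Hausdorff_surface by (intro closedin_Hausdorff_finite) auto
  have "closedin X ?A"
    using finite_face_edges by (intro closedin_Union) (auto simp: face_edges_def closedin_curve)
  then have "?A \<inter> ?S = {} \<or> ?L \<inter> ?S = {}"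
    using cl by (intro connectedin_closed_cover[OF connected_face_boundary(1)[OF F]]) auto
  moreover have AS: "?A \<subseteq> ?S" by (auto simp: face_edges_def support_eq)
  moreover have "?A \<noteq> {}"
  proof -
    have "face_edges G F \<noteq> {}" using card_face_edges[OF F] by auto
    then show ?thesis using infinite_curve by (fastforce simp: face_edges_def)
  qed
  ultimately show ?thesis by blast
qed

lemma face_verts:
  assumes F: "F \<in> faces G"
  shows "verts G \<inter> F = \<Union>(face_edges G F)"
proof -
  have "verts G \<subseteq> support G" by (simp add: support_def)
  then have "verts G \<inter> F = verts G \<inter> (F \<inter> support G)" by blast
  also have "\<dots> = (\<Union>e\<in>face_edges G F. curve G e \<inter> verts G)"
    unfolding face_boundary_eq[OF F] by blast
  also have "\<dots> = \<Union>(face_edges G F)" using curve_verts by (auto simp: face_edges_def)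
  finally show ?thesis .
qed

text \<open>The boundary circle of a face has no cut point, but the neighbour of a leaf would be one.\<close>

lemma face_no_leaf:
  assumes F: "F \<in> faces G" and e: "e \<in> face_edges G F" and x: "x \<in> e"
  shows "\<exists>e'\<in>face_edges G F. e' \<noteq> e \<and> x \<in> e'"
proof (rule ccontr)
  assume leaf: "\<not> ?thesis"
  have eG: "e \<in> edges G" using e by (simp add: face_edges_def)
  obtain y where y: "e = {x, y}" "x \<noteq> y"
    using edge_pair[OF eG] x by (metis doubleton_eq_iff empty_iff insert_iff)
  let ?B = "\<Union>e'\<in>face_edges G F - {e}. curve G e'"
  have "closedin X ?B"
    using finite_face_edges by (intro closedin_Union) (auto simp: face_edges_def closedin_curve)
  then have "curve G e \<inter> (F \<inter> support G - {y}) = {} \<or> ?B \<inter> (F \<inter> support G - {y}) = {}"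
  proof (intro connectedin_closed_cover[OF connected_face_boundary(2)[OF F]])
    show "closedin X (curve G e)" using closedin_curve[OF eG] .
    show "curve G e \<inter> ?B \<inter> (F \<inter> support G - {y}) = {}"
    proof -
      have "curve G e \<inter> curve G e' \<subseteq> {y}" if "e' \<in> face_edges G F - {e}" for e'
      proof -
        have "e' \<in> edges G" "e \<noteq> e'" "x \<notin> e'" using that leaf by (auto simp: face_edges_def)
        then show ?thesis using curve_Int[OF eG, of e'] y by auto
      qed
      then show ?thesis by blast
    qed
  qed (auto simp: face_boundary_eq[OF F])
  moreover have "x \<in> curve G e \<inter> (F \<inter> support G - {y})"
    using curve_subset[OF eG] y e by (auto simp: face_boundary_eq[OF F])
  moreover have "?B \<inter> (F \<inter> support G - {y}) \<noteq> {}"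
  proof -
    have "card (face_edges G F - {e}) = 2" using card_face_edges[OF F] e finite_face_edges by simp
    then obtain e' where e': "e' \<in> face_edges G F" "e' \<noteq> e" by (metis DiffE all_not_in_conv card.empty insertI1 zero_neq_numeral)
    then obtain p where "p \<in> curve G e'" "p \<notin> verts G" using face_edge_nonvertex by (auto simp: face_edges_def)
    moreover have "y \<in> verts G" using y edge_subset[OF eG] by blast
    ultimately show ?thesis using e' by (auto simp: face_boundary_eq[OF F])
  qed
  ultimately show False by blast
qed

lemma face_triangle:
  assumes F: "F \<in> faces G"
  obtains x y z where "x \<noteq> y" "y \<noteq> z" "x \<noteq> z" "verts G \<inter> F = {x, y, z}"
    "face_edges G F = {{x, y}, {y, z}, {x, z}}"
proof -
  have two: "e \<in> edges G" if "e \<in> face_edges G F" for e using that by (simp add: face_edges_def)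
  obtain e1 where e1: "e1 \<in> face_edges G F" using card_face_edges[OF F] by fastforce
  then obtain x y where xy: "e1 = {x, y}" "x \<noteq> y" using two edge_pair by metis
  obtain e2 where e2: "e2 \<in> face_edges G F" "e2 \<noteq> e1" "x \<in> e2" using face_no_leaf[OF F e1] xy by blast
  then obtain z where z: "e2 = {x, z}" "x \<noteq> z" "z \<noteq> y"
    using edge_pair[OF two[OF e2(1)]] xy by (metis doubleton_eq_iff empty_iff insert_iff)
  obtain e3 where e3: "e3 \<in> face_edges G F" "e3 \<noteq> e1" "y \<in> e3" using face_no_leaf[OF F e1] xy by blast
  have ne: "e3 \<noteq> e2" using e3 z xy by auto
  have "{e1, e2, e3} = face_edges G F"
    using e1 e2 e3 ne card_face_edges[OF F] by (intro card_subset_eq[OF finite_face_edges]) auto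
  note eq = this[symmetric]
  obtain e4 where "e4 \<in> face_edges G F" "e4 \<noteq> e2" "z \<in> e4" using face_no_leaf[OF F e2(1)] z by blast
  then have "z \<in> e3" using eq xy z by auto
  then have "e3 = {y, z}"
    using edge_pair[OF two[OF e3(1)]] e3(3) z(3) by (metis doubleton_eq_iff empty_iff insert_iff)
  then show ?thesis using that[of x y z] eq xy z face_verts[OF F] by auto
qed

lemma face_edges_iff:
  assumes F: "F \<in> faces G"
  shows "{x, y} \<in> face_edges G F \<longleftrightarrow> x \<noteq> y \<and> x \<in> verts G \<inter> F \<and> y \<in> verts G \<inter> F"
  by (rule face_triangle[OF F]) (auto simp: doubleton_eq_iff)

lemma card_face_verts: "F \<in> faces G \<Longrightarrow> card (verts G \<inter> F) = 3"
  by (rule face_triangle) auto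

lemma faces_common_edge:
  assumes F: "F \<in> faces G" "F' \<in> faces G" "F \<noteq> F'"
  shows "card (verts G \<inter> (F \<inter> F')) \<le> 2"
proof -
  consider e where "e \<in> edges G" "F \<inter> F' = curve G e" | x where "F \<inter> F' = {x}" | "F \<inter> F' = {}"
    using faces_Int[OF F] by blast
  then show ?thesis
  proof cases
    case 1
    then show ?thesis using curve_verts[of e] card_edge[of e] by (simp add: Int_commute)
  next
    case 2
    then show ?thesis using card_mono[of "{x}" "verts G \<inter> (F \<inter> F')"] by simp
  qed simp
qed

lemma inj_on_face_verts: "inj_on (\<lambda>F. verts G \<inter> F) (faces G)"
proof (rule inj_onI, rule ccontr)
  fix F F' assume *: "F \<in> faces G" "F' \<in> faces G" "verts G \<inter> F = verts G \<inter> F'" "F \<noteq> F'"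
  then have "verts G \<inter> (F \<inter> F') = verts G \<inter> F" by blast
  then show False using faces_common_edge[of F F'] card_face_verts[of F] * by simp
qed

lemma face_edges_nonempty: "F \<in> faces G \<Longrightarrow> face_edges G F \<noteq> {}"
  using card_face_edges by force

lemma finite_faces: "finite (faces G)"
proof -
  have "faces G \<subseteq> (\<Union>e\<in>edges G. {F \<in> faces G. e \<in> face_edges G F})"
  proof
    fix F assume F: "F \<in> faces G"
    then have "face_edges G F \<noteq> {}" using face_edges_nonempty by blast
    then show "F \<in> (\<Union>e\<in>edges G. {F \<in> faces G. e \<in> face_edges G F})"
      using F by (auto simp: face_edges_def)
  qed
  moreover have "finite {F \<in> faces G. e \<in> face_edges G F}" if "e \<in> edges G" for e
    using edge_two_faces[OF that] by (intro card_ge_0_finite) simp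
  ultimately show ?thesis using finite_edges finite_subset by blast
qed

lemma faces_nonempty: "faces G \<noteq> {}"
proof -
  obtain v where "v \<in> verts G"
    using verts_nonempty by blast
  then obtain e where "e \<in> edges G" using vertex_in_edge by blast
  then show ?thesis using edge_in_other_face by blast
qed

lemma Union_faces: "\<Union>(faces G) = topspace X"
proof
  show "\<Union>(faces G) \<subseteq> topspace X" using face_subset by blast
  show "topspace X \<subseteq> \<Union>(faces G)"
  proof
    fix x assume x: "x \<in> topspace X"
    show "x \<in> \<Union>(faces G)"
    proof (cases "x \<in> support G")
      case True
      then obtain e where e: "e \<in> edges G" "x \<in> curve G e" by (auto simp: support_eq)
      obtain F where "F \<in> faces G" "e \<in> face_edges G F"
        using edge_in_other_face[OF e(1)] by metis
      then show ?thesis using e by (auto simp: face_edges_def)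
    next
      case False
      then show ?thesis using component_in_face[of x] x by blast
    qed
  qed
qed

lemma strongly_connected:
  assumes K: "K \<subseteq> faces G" "K \<noteq> {}"
    and step: "\<And>F F' e. F \<in> K \<Longrightarrow> F' \<in> faces G \<Longrightarrow> e \<in> face_edges G F \<Longrightarrow> e \<in> face_edges G F' \<Longrightarrow> F' \<in> K"
  shows "K = faces G"
proof (rule ccontr)
  assume "K \<noteq> faces G"
  then obtain F' where F': "F' \<in> faces G" "F' \<notin> K" using K by blast
  obtain F where F: "F \<in> K" using K by blast
  let ?V = "verts G"
  let ?P = "\<Union>K" let ?Q = "\<Union>(faces G - K)"
  have PQ: "?P \<union> ?Q = topspace X" using K Union_faces by blast
  have cl_Union: "closedin X (\<Union>A)" if "A \<subseteq> faces G" for A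
    using that finite_subset[OF that finite_faces] by (intro closedin_Union) (auto simp: closedin_face)
  have clV: "closedin X ?V"
    using closedin_Hausdorff_finite[OF Hausdorff_surface verts_subset finite_verts] .
  have clP: "closedin X (?P \<union> ?V)" using cl_Union[OF K(1)] clV by blast
  have clQ: "closedin X (?Q \<union> ?V)" using cl_Union[of "faces G - K"] clV by blast
  have PQV: "?P \<inter> ?Q \<subseteq> ?V"
  proof clarify
    fix p A B assume p: "p \<in> A" "A \<in> K" "p \<in> B" "B \<in> faces G" "B \<notin> K"
    then have "(\<exists>e\<in>edges G. A \<inter> B = curve G e) \<or> (\<exists>x\<in>verts G. A \<inter> B = {x}) \<or> A \<inter> B = {}"
      using faces_Int[of A B] K by blast
    moreover have False if "e \<in> edges G" "A \<inter> B = curve G e" for e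
      using step[of A B e] p that by (auto simp: face_edges_def)
    ultimately show "p \<in> ?V" using p by (metis IntI empty_iff singletonD)
  qed
  have inf: "\<not> A \<subseteq> ?V" if A: "A \<in> faces G" for A
  proof -
    obtain e where "e \<in> face_edges G A" using face_edges_nonempty[OF A] by blast
    then have e: "e \<in> edges G" "curve G e \<subseteq> A" by (auto simp: face_edges_def)
    then show ?thesis using infinite_curve[OF e(1)] finite_subset[OF _ finite_verts] order_trans by metis
  qed
  have "topspace X - (?Q \<union> ?V) = {} \<or> topspace X - (?P \<union> ?V) = {}"
  proof (rule locally_planar_connected_minus_finite[OF planar connected_surface finite_verts])
    show "openin X (topspace X - (?Q \<union> ?V))" "openin X (topspace X - (?P \<union> ?V))"
      using clP clQ by blast+
    show "topspace X - (?Q \<union> ?V) \<union> (topspace X - (?P \<union> ?V)) = topspace X - ?V"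
      using PQV by blast
    show "(topspace X - (?Q \<union> ?V)) \<inter> (topspace X - (?P \<union> ?V)) = {}"
      using PQ by blast
  qed
  then show False
  proof
    assume "topspace X - (?Q \<union> ?V) = {}"
    then have "F \<subseteq> ?V" using PQV PQ F by blast
    then show False using inf F K by blast
  next
    assume "topspace X - (?P \<union> ?V) = {}"
    then have "F' \<subseteq> ?V" using PQV PQ F' by blast
    then show False using inf F' by blast
  qed
qed

end

section \<open>Zigzags and first returns\<close>

fun flip :: "'a \<times> 'a \<times> 'a \<Rightarrow> 'a \<times> 'a \<times> 'a" where
  "flip (x, y, z) = (z, y, x)"

lemma flip_flip [simp]: "flip (flip \<phi>) = \<phi>"
  by (cases \<phi>) simp

locale triangle_complex =
  fixes T :: "'a set set"
  assumes finite_triangles: "finite T"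
    and card_triangle: "t \<in> T \<Longrightarrow> card t = 3"
    and neighbour: "t \<in> T \<Longrightarrow> x \<in> t \<Longrightarrow> y \<in> t \<Longrightarrow> x \<noteq> y \<Longrightarrow> \<exists>!s. s \<in> T \<and> s \<noteq> t \<and> x \<in> s \<and> y \<in> s"
    and triangles_nonempty: "T \<noteq> {}"
    and strongly_connected: "K \<subseteq> T \<Longrightarrow> K \<noteq> {} \<Longrightarrow>
      (\<And>s t x y. s \<in> K \<Longrightarrow> t \<in> T \<Longrightarrow> x \<noteq> y \<Longrightarrow> x \<in> s \<inter> t \<Longrightarrow> y \<in> s \<inter> t \<Longrightarrow> t \<in> K) \<Longrightarrow> K = T"
begin

definition flags :: "('a \<times> 'a \<times> 'a) set" where
  "flags = {(x, y, z). {x, y, z} \<in> T}"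

definition opposite :: "'a \<Rightarrow> 'a \<Rightarrow> 'a \<Rightarrow> 'a" where
  "opposite x y z = (THE w. w \<noteq> x \<and> {y, z, w} \<in> T)"

text \<open>Off the flags, \<open>step\<close> is the identity, which makes it injective on the whole type.\<close>

fun step :: "'a \<times> 'a \<times> 'a \<Rightarrow> 'a \<times> 'a \<times> 'a" where
  "step (x, y, z) = (if {x, y, z} \<in> T then (y, z, opposite x y z) else (x, y, z))"

lemma flag_iff: "(x, y, z) \<in> flags \<longleftrightarrow> {x, y, z} \<in> T"
  by (simp add: flags_def)

lemma triangle_distinct: "{x, y, z} \<in> T \<Longrightarrow> x \<noteq> y \<and> y \<noteq> z \<and> x \<noteq> z"
  using card_triangle[of "{x, y, z}"] by (auto simp: card_insert_if split: if_splits)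

lemma triangle_eq: "t \<in> T \<Longrightarrow> x \<in> t \<Longrightarrow> y \<in> t \<Longrightarrow> x \<noteq> y \<Longrightarrow> \<exists>z. t = {x, y, z} \<and> x \<noteq> z \<and> y \<noteq> z"
proof -
  assume t: "t \<in> T" "x \<in> t" "y \<in> t" "x \<noteq> y"
  then have "card (t - {x, y}) = 1"
    using card_triangle[OF t(1)] by (subst card_Diff_subset) auto
  then obtain z where "t - {x, y} = {z}" using card_1_singletonE by blast
  then have "t = {x, y, z} \<and> x \<noteq> z \<and> y \<noteq> z" using t by auto
  then show ?thesis by blast
qed

lemma opposite_ex1:
  assumes t: "{x, y, z} \<in> T"
  shows "\<exists>!w. w \<noteq> x \<and> {y, z, w} \<in> T"
proof -
  have d: "x \<noteq> y" "y \<noteq> z" "x \<noteq> z" using triangle_distinct[OF t] by auto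
  have ex1: "\<exists>!s. s \<in> T \<and> s \<noteq> {x, y, z} \<and> y \<in> s \<and> z \<in> s"
    using neighbour[OF t, of y z] d by simp
  then obtain s where s: "s \<in> T" "s \<noteq> {x, y, z}" "y \<in> s" "z \<in> s" by blast
  have uniq: "s' = s" if "s' \<in> T" "s' \<noteq> {x, y, z}" "y \<in> s'" "z \<in> s'" for s'
    using ex1 s that by (elim ex1E) metis
  obtain w where w: "s = {y, z, w}" using triangle_eq[of s y z] s d by blast
  show ?thesis
  proof (rule ex1I[of _ w])
    show "w \<noteq> x \<and> {y, z, w} \<in> T" using s w by auto
    fix w' assume w': "w' \<noteq> x \<and> {y, z, w'} \<in> T"
    then have "{y, z, w'} \<noteq> {x, y, z}" using triangle_distinct[of y z w'] by auto
    then have "{y, z, w'} = {y, z, w}" using uniq[of "{y, z, w'}"] w w' by simp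
    then show "w' = w" using triangle_distinct[of y z w'] w' by auto
  qed
qed

lemma step_eqI:
  assumes "(x, y, z) \<in> flags" "(y, z, w) \<in> flags" "w \<noteq> x"
  shows "step (x, y, z) = (y, z, w)"
proof -
  have "opposite x y z = w"
    unfolding opposite_def using opposite_ex1[of x y z] assms
    by (intro the1_equality) (auto simp: flag_iff)
  then show ?thesis using assms by (simp add: flag_iff)
qed

lemma step_flagE:
  assumes "(x, y, z) \<in> flags"
  obtains w where "step (x, y, z) = (y, z, w)" "(y, z, w) \<in> flags" "w \<noteq> x"
proof -
  obtain w where "w \<noteq> x" "(y, z, w) \<in> flags"
    using opposite_ex1[of x y z] assms by (auto simp: flag_iff)
  then show ?thesis using that step_eqI[OF assms] by blast
qed

lemma step_flags: "\<phi> \<in> flags \<Longrightarrow> step \<phi> \<in> flags"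
  by (cases \<phi>) (metis step_flagE)

lemma funpow_step_flags: "\<phi> \<in> flags \<Longrightarrow> (step ^^ n) \<phi> \<in> flags"
  by (induction n) (auto simp: step_flags)

lemma flip_flags: "\<phi> \<in> flags \<Longrightarrow> flip \<phi> \<in> flags"
  by (cases \<phi>) (simp add: flag_iff insert_commute)

lemma step_flip_step:
  assumes "\<phi> \<in> flags"
  shows "step (flip (step \<phi>)) = flip \<phi>"
proof -
  obtain x y z where \<phi>: "\<phi> = (x, y, z)" by (cases \<phi>)
  then obtain w where w: "step (x, y, z) = (y, z, w)" "(y, z, w) \<in> flags" "w \<noteq> x"
    using assms step_flagE by metis
  then have "step (w, z, y) = (z, y, x)"
    using flip_flags[OF w(2)] flip_flags[OF assms] \<phi> by (intro step_eqI) auto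
  then show ?thesis using \<phi> w by simp
qed

lemma step_nonflag: "\<phi> \<notin> flags \<Longrightarrow> step \<phi> = \<phi>"
  by (cases \<phi>) (simp add: flag_iff)

lemma inj_step: "inj step"
proof (rule injI)
  fix \<phi> \<psi> assume eq: "step \<phi> = step \<psi>"
  show "\<phi> = \<psi>"
  proof (cases "\<phi> \<in> flags \<longleftrightarrow> \<psi> \<in> flags")
    case True
    then show ?thesis using eq step_flip_step step_nonflag flip_flip by metis
  next
    case False
    then show ?thesis using eq step_flags step_nonflag by metis
  qed
qed

lemma finite_flags: "finite flags"
proof -
  have "finite (\<Union>T)" using finite_triangles card_triangle by (metis card.infinite finite_Union zero_neq_numeral)
  moreover have "flags \<subseteq> \<Union>T \<times> \<Union>T \<times> \<Union>T" by (auto simp: flags_def)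
  ultimately show ?thesis using finite_subset finite_SigmaI by metis
qed

lemma step_periodic:
  assumes "\<phi> \<in> flags"
  obtains n where "n > 0" "(step ^^ n) \<phi> = \<phi>"
proof (rule funpow_inj_finite[OF inj_step])
  have "{\<psi>. \<exists>n. \<psi> = (step ^^ n) \<phi>} \<subseteq> flags" using assms funpow_step_flags by blast
  then show "finite {\<psi>. \<exists>n. \<psi> = (step ^^ n) \<phi>}" using finite_subset[OF _ finite_flags] by blast
qed (rule that)

lemma funpow_flip_funpow:
  assumes "\<phi> \<in> flags"
  shows "(step ^^ n) (flip ((step ^^ n) \<phi>)) = flip \<phi>"
proof (induction n)
  case (Suc n)
  have "(step ^^ Suc n) (flip ((step ^^ Suc n) \<phi>)) = (step ^^ n) (step (flip (step ((step ^^ n) \<phi>))))"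
    by (simp add: funpow_swap1)
  also have "\<dots> = flip \<phi>" using Suc step_flip_step[OF funpow_step_flags[OF assms]] by simp
  finally show ?case .
qed simp

text \<open>A zigzag that met its own reverse would be symmetric about one of its vertices or edges.\<close>

lemma funpow_step_neq_flip: "\<phi> \<in> flags \<Longrightarrow> (step ^^ n) \<phi> \<noteq> flip \<phi>"
proof (induction n arbitrary: \<phi> rule: less_induct)
  case (less n)
  obtain x y z where \<phi>: "\<phi> = (x, y, z)" by (cases \<phi>)
  have d: "x \<noteq> y" "y \<noteq> z" "x \<noteq> z" using less.prems triangle_distinct \<phi> by (auto simp: flag_iff)
  obtain w where w: "step (x, y, z) = (y, z, w)" using less.prems \<phi> step_flagE by metis
  consider "n = 0" | "n = 1" | m where "n = Suc (Suc m)" by (metis One_nat_def not0_implies_Suc)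
  then show ?case
  proof cases
    case 3
    show ?thesis
    proof
      assume "(step ^^ n) \<phi> = flip \<phi>"
      then have "step ((step ^^ m) (step \<phi>)) = step (flip (step \<phi>))"
        using 3 step_flip_step[OF less.prems] by (simp add: funpow_swap1)
      then have "(step ^^ m) (step \<phi>) = flip (step \<phi>)" using inj_step injD by metis
      then show False using less.IH[of m "step \<phi>"] 3 step_flags[OF less.prems] by simp
    qed
  qed (use \<phi> d w in auto)
qed

definition reach :: "'a \<times> 'a \<times> 'a \<Rightarrow> 'a \<times> 'a \<times> 'a \<Rightarrow> bool" where
  "reach \<phi> \<psi> \<longleftrightarrow> (\<exists>n. \<psi> = (step ^^ n) \<phi>)"

lemma reachI: "reach \<phi> ((step ^^ n) \<phi>)"
  unfolding reach_def by blast

lemma reach_refl: "reach \<phi> \<phi>"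
  using reachI[of \<phi> 0] by simp

lemma reach_trans: "reach \<phi> \<psi> \<Longrightarrow> reach \<psi> \<theta> \<Longrightarrow> reach \<phi> \<theta>"
  unfolding reach_def by (metis comp_apply funpow_add)

lemma reach_flags: "reach \<phi> \<psi> \<Longrightarrow> \<phi> \<in> flags \<Longrightarrow> \<psi> \<in> flags"
  unfolding reach_def using funpow_step_flags by blast

lemma funpow_fixed_mult:
  fixes f :: "'b \<Rightarrow> 'b"
  shows "(f ^^ p) x = x \<Longrightarrow> (f ^^ (p * k)) x = x"
  by (induction k) (auto simp: funpow_add)

lemma reach_sym:
  assumes "\<phi> \<in> flags" "reach \<phi> \<psi>"
  shows "reach \<psi> \<phi>"
proof -
  obtain n where n: "\<psi> = (step ^^ n) \<phi>" using assms reach_def by blast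
  obtain p where p: "p > 0" "(step ^^ p) \<phi> = \<phi>" using step_periodic[OF assms(1)] .
  have "p * n - n + n = p * n" using p by simp
  then have "(step ^^ (p * n - n)) \<psi> = \<phi>"
    using funpow_fixed_mult[OF p(2), of n] n by (metis comp_apply funpow_add)
  then show ?thesis unfolding reach_def by blast
qed

lemma reach_flip:
  assumes "\<phi> \<in> flags" "reach \<phi> \<psi>"
  shows "reach (flip \<phi>) (flip \<psi>)"
proof -
  have "reach (flip \<psi>) (flip \<phi>)"
    using assms funpow_flip_funpow unfolding reach_def by metis
  then show ?thesis
    using reach_sym flip_flags reach_flags assms by blast
qed

definition same_zigzag :: "'a \<times> 'a \<times> 'a \<Rightarrow> 'a \<times> 'a \<times> 'a \<Rightarrow> bool" where
  "same_zigzag \<phi> \<psi> \<longleftrightarrow> reach \<phi> \<psi> \<or> reach \<phi> (flip \<psi>)"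

lemma same_zigzag_sym: "\<phi> \<in> flags \<Longrightarrow> same_zigzag \<phi> \<psi> \<Longrightarrow> same_zigzag \<psi> \<phi>"
  unfolding same_zigzag_def using reach_sym reach_flip flip_flip flip_flags by metis

lemma same_zigzag_trans:
  "\<phi> \<in> flags \<Longrightarrow> \<psi> \<in> flags \<Longrightarrow> same_zigzag \<phi> \<psi> \<Longrightarrow> same_zigzag \<psi> \<theta> \<Longrightarrow> same_zigzag \<phi> \<theta>"
  unfolding same_zigzag_def using reach_trans reach_flip flip_flip by metis

lemma same_zigzag_flip: "same_zigzag \<phi> (flip \<phi>)"
  unfolding same_zigzag_def using reach_refl by simp

definition knotted :: bool where
  "knotted \<longleftrightarrow> (\<forall>\<phi>\<in>flags. \<forall>\<psi>\<in>flags. same_zigzag \<phi> \<psi>)"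

definition zigzag_from :: "'a \<times> 'a \<times> 'a \<Rightarrow> nat \<Rightarrow> 'a" where
  "zigzag_from \<phi> i = fst ((step ^^ i) \<phi>)"

definition is_zigzag :: "(nat \<Rightarrow> 'a) \<Rightarrow> bool" where
  "is_zigzag v \<longleftrightarrow> (\<forall>i. {v i, v (Suc i), v (Suc (Suc i))} \<in> T \<and> v (Suc (Suc (Suc i))) \<noteq> v i)"

lemma funpow_zigzag_from:
  assumes "\<phi> \<in> flags"
  shows "(step ^^ i) \<phi> = (zigzag_from \<phi> i, zigzag_from \<phi> (Suc i), zigzag_from \<phi> (Suc (Suc i)))"
proof -
  obtain x y z where xyz: "(step ^^ i) \<phi> = (x, y, z)" by (metis prod_cases3)
  then have "(x, y, z) \<in> flags" using funpow_step_flags[OF assms] by metis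
  then obtain w where w: "step (x, y, z) = (y, z, w)" "(y, z, w) \<in> flags" using step_flagE by metis
  then obtain u where u: "step (y, z, w) = (z, w, u)" using step_flagE by metis
  show ?thesis using xyz w u by (simp add: zigzag_from_def)
qed

lemma is_zigzag_from:
  assumes "\<phi> \<in> flags"
  shows "is_zigzag (zigzag_from \<phi>)"
  unfolding is_zigzag_def
proof (intro allI conjI)
  fix i
  let ?v = "zigzag_from \<phi>"
  have fl: "(?v i, ?v (Suc i), ?v (Suc (Suc i))) \<in> flags"
    using funpow_step_flags[OF assms] funpow_zigzag_from[OF assms] by metis
  then show "{?v i, ?v (Suc i), ?v (Suc (Suc i))} \<in> T" by (simp add: flag_iff)
  have "step (?v i, ?v (Suc i), ?v (Suc (Suc i))) = (?v (Suc i), ?v (Suc (Suc i)), ?v (Suc (Suc (Suc i))))"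
    using funpow_zigzag_from[OF assms, of i] funpow_zigzag_from[OF assms, of "Suc i"] by simp
  then show "?v (Suc (Suc (Suc i))) \<noteq> ?v i" using step_flagE[OF fl] by (metis prod.inject)
qed

lemma is_zigzag_eq:
  assumes v: "is_zigzag v"
  shows "v = zigzag_from (v 0, v 1, v 2)" "(v 0, v 1, v 2) \<in> flags"
proof -
  have "(step ^^ i) (v 0, v 1, v 2) = (v i, v (Suc i), v (Suc (Suc i)))" for i
  proof (induction i)
    case 0
    then show ?case by (simp add: numeral_2_eq_2)
  next
    case (Suc i)
    have "step (v i, v (Suc i), v (Suc (Suc i))) = (v (Suc i), v (Suc (Suc i)), v (Suc (Suc (Suc i))))"
      using v by (intro step_eqI) (auto simp: is_zigzag_def flag_iff)
    then show ?case using Suc by simp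
  qed
  then show "v = zigzag_from (v 0, v 1, v 2)" by (auto simp: zigzag_from_def)
  show "(v 0, v 1, v 2) \<in> flags"
    using v by (simp add: is_zigzag_def flag_iff numeral_2_eq_2)
qed

lemma zigzag_from_inj:
  assumes "\<phi> \<in> flags" "\<psi> \<in> flags" "zigzag_from \<phi> = zigzag_from \<psi>"
  shows "\<phi> = \<psi>"
  using funpow_zigzag_from[OF assms(1), of 0] funpow_zigzag_from[OF assms(2), of 0] assms(3) by simp

lemma zigzag_from_shift: "zigzag_from \<phi> (i + k) = zigzag_from ((step ^^ k) \<phi>) i"
  by (simp add: zigzag_from_def funpow_add)

lemma cyclic_seq_zigzag_from: "cyclic_seq (zigzag_from \<phi>) = {zigzag_from \<psi> |\<psi>. reach \<phi> \<psi>}"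
  unfolding cyclic_seq_def reach_def zigzag_from_shift by metis

lemma cyclic_seq_eq_iff:
  assumes "\<phi> \<in> flags" "\<psi> \<in> flags"
  shows "cyclic_seq (zigzag_from \<phi>) = cyclic_seq (zigzag_from \<psi>) \<longleftrightarrow> reach \<phi> \<psi>"
proof
  assume "cyclic_seq (zigzag_from \<phi>) = cyclic_seq (zigzag_from \<psi>)"
  moreover have "zigzag_from \<psi> \<in> cyclic_seq (zigzag_from \<psi>)"
    using reach_refl unfolding cyclic_seq_zigzag_from by blast
  ultimately obtain \<theta> where "reach \<phi> \<theta>" "zigzag_from \<psi> = zigzag_from \<theta>"
    unfolding cyclic_seq_zigzag_from by blast
  then show "reach \<phi> \<psi>" using zigzag_from_inj assms reach_flags by metis
next
  assume "reach \<phi> \<psi>"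
  then have "reach \<phi> \<theta> \<longleftrightarrow> reach \<psi> \<theta>" for \<theta>
    using reach_sym assms reach_trans by blast
  then show "cyclic_seq (zigzag_from \<phi>) = cyclic_seq (zigzag_from \<psi>)"
    unfolding cyclic_seq_zigzag_from by simp
qed

lemma periodic_add_mult:
  fixes v :: "nat \<Rightarrow> 'b"
  assumes "\<And>i. v (i + p) = v i"
  shows "v (i + p * k) = v i"
proof (induction k)
  case (Suc k)
  have "i + p * Suc k = i + p * k + p" by simp
  then show ?case using Suc assms by metis
qed simp

lemma reversed_zigzag_from:
  assumes "\<phi> \<in> flags"
  obtains \<theta> where "\<theta> \<in> flags" "reach (flip \<phi>) \<theta>" "reversed (zigzag_from \<phi>) = zigzag_from \<theta>"
proof -
  let ?v = "zigzag_from \<phi>"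
  define p where "p = period ?v"
  obtain n where n: "n > 0" "(step ^^ n) \<phi> = \<phi>" using step_periodic[OF assms] .
  then have "\<exists>n>0. \<forall>i. ?v (i + n) = ?v i" using zigzag_from_shift by metis
  then have "p > 0 \<and> (\<forall>i. ?v (i + p) = ?v i)"
    unfolding p_def period_def by (rule LeastI_ex)
  then have p: "p > 0" "\<And>i. ?v (i + p) = ?v i" by auto
  have large: "i + 4 \<le> p * (i + 4)" for i using p(1) by (cases p) auto
  have zz: "is_zigzag ?v" using is_zigzag_from[OF assms] .
  have rev: "reversed ?v (i + j) = ?v (p * (i + 4) - i - j)" if "j \<le> 3" for i j
  proof -
    define a where "a = p - (i + j) mod p"
    define b where "b = p * (i + 4) - i - j"
    have b: "b + (i + j) = p * (i + 4)" using large[of i] that unfolding b_def by linarith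
    have "(i + j) mod p < p" using p(1) by simp
    then have a: "a + (i + j) = p * (1 + (i + j) div p)"
      using mult_div_mod_eq[of p "i + j"] unfolding a_def distrib_left mult_1_right by linarith
    have "a + p * (i + 4) = b + p * (1 + (i + j) div p)" using a b by linarith
    then have "?v a = ?v b" using periodic_add_mult[of ?v p] p(2) by metis
    then show ?thesis unfolding reversed_def p_def[symmetric] a_def b_def .
  qed
  have rev_zz: "is_zigzag (reversed ?v)"
    unfolding is_zigzag_def
  proof
    fix i
    obtain l where l: "p * (i + 4) - i = Suc (Suc (Suc l))"
      by (intro that[of "p * (i + 4) - i - 3"]) (use large[of i] in linarith)
    have "reversed ?v i = ?v (Suc (Suc (Suc l)))" "reversed ?v (Suc i) = ?v (Suc (Suc l))"
      "reversed ?v (Suc (Suc i)) = ?v (Suc l)" "reversed ?v (Suc (Suc (Suc i))) = ?v l"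
      using rev[of 0 i, unfolded l] rev[of 1 i, unfolded l] rev[of 2 i, unfolded l] rev[of 3 i, unfolded l]
      by (simp_all add: numeral_3_eq_3)
    moreover have "{?v (Suc l), ?v (Suc (Suc l)), ?v (Suc (Suc (Suc l)))} \<in> T" "?v (Suc (Suc (Suc l))) \<noteq> ?v l"
      using zz unfolding is_zigzag_def by auto
    ultimately show "{reversed ?v i, reversed ?v (Suc i), reversed ?v (Suc (Suc i))} \<in> T \<and>
        reversed ?v (Suc (Suc (Suc i))) \<noteq> reversed ?v i"
      by (simp add: insert_commute)
  qed
  let ?r = "reversed ?v"
  let ?l = "p * 4 - 2"
  have "p * 4 \<ge> 4" using p(1) by simp
  then have "Suc ?l = p * 4 - 1" "Suc (Suc ?l) = p * 4" by auto
  then have "(?r 0, ?r 1, ?r 2) = flip ((step ^^ ?l) \<phi>)"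
    using rev[of 0 0] rev[of 1 0] rev[of 2 0] funpow_zigzag_from[OF assms, of ?l] by (simp add: numeral_2_eq_2)
  moreover have "reach (flip \<phi>) (flip ((step ^^ ?l) \<phi>))"
    using reach_flip[OF assms reachI] .
  ultimately show ?thesis using that is_zigzag_eq[OF rev_zz] by metis
qed

lemma knotted_iff_cyclic_seq:
  "(\<exists>v. is_zigzag v \<and> {cyclic_seq w | w. is_zigzag w} = {cyclic_seq v, cyclic_seq (reversed v)}) \<longleftrightarrow> knotted"
proof
  assume "\<exists>v. is_zigzag v \<and> {cyclic_seq w | w. is_zigzag w} = {cyclic_seq v, cyclic_seq (reversed v)}"
  then obtain v where v: "is_zigzag v"
    and eq: "{cyclic_seq w | w. is_zigzag w} = {cyclic_seq v, cyclic_seq (reversed v)}" by blast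
  obtain \<phi> where \<phi>: "\<phi> \<in> flags" "v = zigzag_from \<phi>" using is_zigzag_eq[OF v] by blast
  obtain \<theta> where \<theta>: "\<theta> \<in> flags" "reach (flip \<phi>) \<theta>" "reversed v = zigzag_from \<theta>"
    using reversed_zigzag_from[OF \<phi>(1)] \<phi>(2) by metis
  have "same_zigzag \<phi> \<psi>" if \<psi>: "\<psi> \<in> flags" for \<psi>
  proof -
    have "cyclic_seq (zigzag_from \<psi>) \<in> {cyclic_seq v, cyclic_seq (reversed v)}"
      using eq is_zigzag_from[OF \<psi>] by blast
    then have "cyclic_seq (zigzag_from \<phi>) = cyclic_seq (zigzag_from \<psi>) \<or>
        cyclic_seq (zigzag_from \<theta>) = cyclic_seq (zigzag_from \<psi>)"
      using \<phi>(2) \<theta>(3) by auto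
    then have "reach \<phi> \<psi> \<or> reach \<theta> \<psi>"
      using cyclic_seq_eq_iff[OF \<phi>(1) \<psi>] cyclic_seq_eq_iff[OF \<theta>(1) \<psi>] by simp
    then have "reach \<phi> \<psi> \<or> reach (flip \<phi>) \<psi>" using \<theta>(2) reach_trans by blast
    then show ?thesis
      unfolding same_zigzag_def using reach_flip[OF flip_flags[OF \<phi>(1)]] by (metis flip_flip)
  qed
  then show knotted
    unfolding knotted_def using same_zigzag_sym same_zigzag_trans \<phi>(1) by blast
next
  assume kn: knotted
  obtain t where t: "t \<in> T" using triangles_nonempty by blast
  obtain x y z where "t = {x, y, z}" using card_triangle[OF t] by (auto simp: card_3_iff)
  then have \<phi>: "(x, y, z) \<in> flags" (is "?\<phi> \<in> _") using t by (simp add: flag_iff)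
  let ?v = "zigzag_from ?\<phi>"
  obtain \<theta> where \<theta>: "\<theta> \<in> flags" "reach (flip ?\<phi>) \<theta>" "reversed ?v = zigzag_from \<theta>"
    using reversed_zigzag_from[OF \<phi>] by metis
  have "{cyclic_seq w | w. is_zigzag w} = {cyclic_seq ?v, cyclic_seq (reversed ?v)}"
  proof (intro equalityI subsetI)
    fix c assume "c \<in> {cyclic_seq w | w. is_zigzag w}"
    then obtain w where w: "is_zigzag w" "c = cyclic_seq w" by blast
    then obtain \<psi> where \<psi>: "\<psi> \<in> flags" "c = cyclic_seq (zigzag_from \<psi>)"
      using is_zigzag_eq[OF w(1)] by metis
    then have "reach ?\<phi> \<psi> \<or> reach ?\<phi> (flip \<psi>)"
      using kn \<phi> unfolding knotted_def same_zigzag_def by blast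
    then have "reach ?\<phi> \<psi> \<or> reach (flip ?\<phi>) \<psi>" using reach_flip[OF \<phi>] flip_flip by metis
    then have "reach ?\<phi> \<psi> \<or> reach \<theta> \<psi>"
      using \<theta>(2) reach_sym[OF flip_flags[OF \<phi>]] reach_trans by blast
    then show "c \<in> {cyclic_seq ?v, cyclic_seq (reversed ?v)}"
      using cyclic_seq_eq_iff[OF \<phi> \<psi>(1)] cyclic_seq_eq_iff[OF \<theta>(1) \<psi>(1)] \<theta>(3) \<psi>(2) by auto
  next
    fix c assume "c \<in> {cyclic_seq ?v, cyclic_seq (reversed ?v)}"
    moreover have "is_zigzag ?v" "is_zigzag (reversed ?v)"
      using is_zigzag_from[OF \<phi>] is_zigzag_from[OF \<theta>(1)] \<theta>(3) by auto
    ultimately show "c \<in> {cyclic_seq w | w. is_zigzag w}" by blast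
  qed
  then show "\<exists>v. is_zigzag v \<and> {cyclic_seq w | w. is_zigzag w} = {cyclic_seq v, cyclic_seq (reversed v)}"
    using is_zigzag_from[OF \<phi>] by blast
qed

definition flags_of :: "'a set \<Rightarrow> ('a \<times> 'a \<times> 'a) set" where
  "flags_of t = {(x, y, z). {x, y, z} = t}"

definition returns :: "'a set \<Rightarrow> 'a \<times> 'a \<times> 'a \<Rightarrow> nat \<Rightarrow> bool" where
  "returns t \<phi> k \<longleftrightarrow> k > 0 \<and> (step ^^ k) \<phi> \<in> flags_of t \<and> (\<forall>j. 0 < j \<and> j < k \<longrightarrow> (step ^^ j) \<phi> \<notin> flags_of t)"

text \<open>The \<open>k\<close>-th flag after \<open>(z, x, y)\<close> is entered through its first oriented edge, whereas
  \<open>(x, y)\<close> is the second oriented edge of \<open>(z, x, y)\<close>.\<close>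

definition is_monodromy :: "'a set \<Rightarrow> ('a \<times> 'a \<Rightarrow> 'a \<times> 'a) \<Rightarrow> bool" where
  "is_monodromy t M \<longleftrightarrow> (\<forall>x y z. {x, y, z} = t \<longrightarrow>
     (\<exists>k p q r. returns t (z, x, y) k \<and> (step ^^ k) (z, x, y) = (p, q, r) \<and> M (x, y) = (p, q)))"

lemma flags_of_subset: "t \<in> T \<Longrightarrow> flags_of t \<subseteq> flags"
  by (auto simp: flags_of_def flag_iff)

lemma flip_flags_of: "\<phi> \<in> flags_of t \<longleftrightarrow> flip \<phi> \<in> flags_of t"
  by (cases \<phi>) (auto simp: flags_of_def insert_commute)

lemma step_not_flags_of:
  assumes t: "t \<in> T" and \<phi>: "\<phi> \<in> flags_of t"
  shows "step \<phi> \<notin> flags_of t"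
proof -
  obtain x y z where xyz: "\<phi> = (x, y, z)" "{x, y, z} = t" using \<phi> by (auto simp: flags_of_def)
  then have fl: "(x, y, z) \<in> flags" using t by (simp add: flag_iff)
  then obtain w where w: "step (x, y, z) = (y, z, w)" "(y, z, w) \<in> flags" "w \<noteq> x" using step_flagE by metis
  have "w \<notin> t" using triangle_distinct[of y z w] w xyz by (auto simp: flag_iff)
  then show ?thesis using w xyz by (auto simp: flags_of_def)
qed

lemma zigzag_enters:
  assumes t: "t \<in> T" and \<phi>: "\<phi> \<in> flags" and ends: "fst \<phi> \<in> t" "fst (snd \<phi>) \<in> t" and s: "step \<psi> = \<phi>" "\<psi> \<in> flags"
  shows "\<phi> \<in> flags_of t \<or> \<psi> \<in> flags_of t"
proof -
  obtain x y z where \<psi>: "\<psi> = (x, y, z)" by (cases \<psi>)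
  then obtain w where w: "step (x, y, z) = (y, z, w)" "(y, z, w) \<in> flags" "w \<noteq> x" using s step_flagE by metis
  have fl: "{x, y, z} \<in> T" using s \<psi> by (simp add: flag_iff)
  have d: "x \<noteq> y" "y \<noteq> z" "x \<noteq> z" using triangle_distinct[OF fl] by auto
  have \<phi>': "\<phi> = (y, z, w)" using s(1) w(1) \<psi> by (simp del: step.simps)
  then have yz: "y \<in> t" "z \<in> t" using ends by auto
  obtain u where u: "t = {y, z, u}" using triangle_eq[OF t yz] d by blast
  have "u = x \<or> u = w"
    using opposite_ex1[OF fl] t w u by (auto simp: flag_iff)
  then show ?thesis using u \<phi>' \<psi> by (auto simp: flags_of_def)
qed

lemma returns_exists:
  assumes t: "t \<in> T" and xyz: "{x, y, z} = t" and v: "v = zigzag_from (z, x, y)"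
    and n: "n = (LEAST n. n > 1 \<and> v n \<in> t \<and> v (Suc n) \<in> t)"
  shows "\<exists>r. returns t (z, x, y) n \<and> (step ^^ n) (z, x, y) = (v n, v (Suc n), r)"
proof -
  have zxy: "(z, x, y) \<in> flags_of t" using xyz by (auto simp: flags_of_def)
  then have fl: "(z, x, y) \<in> flags" using flags_of_subset[OF t] by blast
  note pow = funpow_zigzag_from[OF fl, folded v]
  have first: "step (z, x, y) \<notin> flags_of t" using step_not_flags_of[OF t zxy] .
  obtain p where p: "p > 0" "(step ^^ p) (z, x, y) = (z, x, y)" using step_periodic[OF fl] .
  have "p \<noteq> 1" using p first zxy by auto
  then have "p > 1" using p(1) by simp
  moreover have "v p \<in> t" "v (Suc p) \<in> t" using pow[of p] p(2) xyz by auto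
  ultimately have "n > 1 \<and> v n \<in> t \<and> v (Suc n) \<in> t" unfolding n by (intro LeastI) blast
  then have n1: "n > 1" "v n \<in> t" "v (Suc n) \<in> t" by auto
  have min: "\<not> (v j \<in> t \<and> v (Suc j) \<in> t)" if "1 < j" "j < n" for j
    using not_less_Least[of j] that n by blast
  have no: "(step ^^ j) (z, x, y) \<notin> flags_of t" if "0 < j" "j < n" for j
  proof (cases "j = 1")
    case True
    then show ?thesis using first by simp
  next
    case False
    then show ?thesis using min[of j] that pow[of j] by (auto simp: flags_of_def)
  qed
  obtain m where m: "n = Suc m" using n1 by (cases n) auto
  have "(step ^^ n) (z, x, y) \<in> flags_of t \<or> (step ^^ m) (z, x, y) \<in> flags_of t"
  proof (rule zigzag_enters[OF t])
    show "fst ((step ^^ n) (z, x, y)) \<in> t" "fst (snd ((step ^^ n) (z, x, y))) \<in> t"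
      using n1 pow[of n] by auto
    show "step ((step ^^ m) (z, x, y)) = (step ^^ n) (z, x, y)" by (simp add: m)
  qed (rule funpow_step_flags[OF fl])+
  then have "(step ^^ n) (z, x, y) \<in> flags_of t" using no[of m] n1 m by auto
  then show ?thesis using no n1 pow[of n] unfolding returns_def by auto
qed

lemma returns_flip:
  assumes t: "t \<in> T" and \<phi>: "\<phi> \<in> flags_of t" and k: "returns t \<phi> k"
  shows "returns t (flip ((step ^^ k) \<phi>)) k" "(step ^^ k) (flip ((step ^^ k) \<phi>)) = flip \<phi>"
proof -
  have fl: "\<phi> \<in> flags" using \<phi> flags_of_subset[OF t] by blast
  show eq: "(step ^^ k) (flip ((step ^^ k) \<phi>)) = flip \<phi>" using funpow_flip_funpow[OF fl] .
  have "(step ^^ j) (flip ((step ^^ k) \<phi>)) = flip ((step ^^ (k - j)) \<phi>)" if "j \<le> k" for j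
  proof -
    have "(step ^^ k) \<phi> = (step ^^ j) ((step ^^ (k - j)) \<phi>)"
      using that by (metis comp_apply funpow_add le_add_diff_inverse)
    then show ?thesis using funpow_flip_funpow[OF funpow_step_flags[OF fl]] by metis
  qed
  then show "returns t (flip ((step ^^ k) \<phi>)) k"
    using k \<phi> eq flip_flags_of unfolding returns_def
    by (metis diff_less less_imp_le_nat zero_less_diff)
qed

lemma monodromyE:
  assumes "is_monodromy t M" "{x, y, z} = t"
  obtains k p q r where "returns t (z, x, y) k" "(step ^^ k) (z, x, y) = (p, q, r)" "M (x, y) = (p, q)" "{p, q, r} = t"
proof -
  obtain k p q r where *: "returns t (z, x, y) k" "(step ^^ k) (z, x, y) = (p, q, r)" "M (x, y) = (p, q)"
    using assms(1)[unfolded is_monodromy_def, rule_format, OF assms(2)] by (elim exE conjE)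
  moreover have "{p, q, r} = t" using * by (auto simp: returns_def flags_of_def)
  ultimately show ?thesis by (rule that)
qed

lemma returns_unique: "returns t \<phi> k \<Longrightarrow> returns t \<phi> l \<Longrightarrow> k = l"
  unfolding returns_def by (metis linorder_neqE_nat)

context
  fixes t M x y z
  assumes t: "t \<in> T" and M: "is_monodromy t M" and xyz: "{x, y, z} = t"
begin

lemma flag_zxy: "(z, x, y) \<in> flags_of t" "(z, x, y) \<in> flags"
  using xyz t flags_of_subset[OF t] by (auto simp: flags_of_def)

lemma monodromy_swap: "M (prod.swap (M (x, y))) = (y, x)"
proof -
  obtain k p q r where *: "returns t (z, x, y) k" "(step ^^ k) (z, x, y) = (p, q, r)" "M (x, y) = (p, q)" "{p, q, r} = t"
    using monodromyE[OF M xyz] .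
  have ret: "returns t (r, q, p) k" "(step ^^ k) (r, q, p) = (y, x, z)"
    using returns_flip[OF t flag_zxy(1) *(1)] *(2) by auto
  have "{q, p, r} = t" using *(4) by auto
  then obtain k' p' q' r' where "returns t (r, q, p) k'" "(step ^^ k') (r, q, p) = (p', q', r')" "M (q, p) = (p', q')"
    using monodromyE[OF M] by metis
  then show ?thesis using ret returns_unique *(3) by (metis prod.inject swap_simp)
qed

lemma monodromy_in: "\<exists>p q. M (x, y) = (p, q) \<and> p \<noteq> q \<and> p \<in> t \<and> q \<in> t"
proof -
  obtain k p q r where *: "M (x, y) = (p, q)" "{p, q, r} = t"
    using monodromyE[OF M xyz] by metis
  then show ?thesis using triangle_distinct[of p q r] t by auto
qed

lemma monodromy_neq_swap: "M (x, y) \<noteq> (y, x)"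
proof
  assume eq: "M (x, y) = (y, x)"
  obtain k p q r where *: "(step ^^ k) (z, x, y) = (p, q, r)" "M (x, y) = (p, q)" "{p, q, r} = t"
    using monodromyE[OF M xyz] by metis
  have "{x, y, r} = {x, y, z}" using eq * xyz by auto
  then have "r = z" using triangle_distinct[of x y z] triangle_distinct[of x y r] xyz t by auto
  then have "(step ^^ k) (z, x, y) = flip (z, x, y)" using eq * by simp
  then show False using funpow_step_neq_flip[OF flag_zxy(2)] by blast
qed

lemma monodromy_same_zigzag: "M (x, y) = (p, q) \<Longrightarrow> {p, q, r} = t \<Longrightarrow> same_zigzag (z, x, y) (p, q, r)"
proof -
  assume M': "M (x, y) = (p, q)" and pqr: "{p, q, r} = t"
  obtain k p' q' r' where *: "(step ^^ k) (z, x, y) = (p', q', r')" "M (x, y) = (p', q')" "{p', q', r'} = t"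
    using monodromyE[OF M xyz] by metis
  have "p' = p" "q' = q" using * M' by auto
  moreover from this have "r' = r"
    using triangle_distinct[of p q r] triangle_distinct[of p q r'] pqr * t by auto
  ultimately have "(p, q, r) = (step ^^ k) (z, x, y)" using * by simp
  then show ?thesis unfolding same_zigzag_def reach_def by blast
qed

text \<open>Otherwise the zigzag of the flag \<open>(z, x, y)\<close> meets no other flag of the face.\<close>

lemma knotted_monodromy_neq:
  assumes kn: knotted
  shows "M (x, y) \<noteq> (z, x)"
proof
  assume eq: "M (x, y) = (z, x)"
  obtain k p q r where *: "returns t (z, x, y) k" "(step ^^ k) (z, x, y) = (p, q, r)" "M (x, y) = (p, q)" "{p, q, r} = t"
    using monodromyE[OF M xyz] .
  have d: "x \<noteq> y" "y \<noteq> z" "x \<noteq> z" using triangle_distinct[of x y z] xyz t by auto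
  have "r = y" using * eq xyz d by auto
  then have per: "(step ^^ k) (z, x, y) = (z, x, y)" using * eq by simp
  have only: "(step ^^ n) (z, x, y) = (z, x, y)" if "(step ^^ n) (z, x, y) \<in> flags_of t" for n
  proof -
    have k: "k > 0" using * by (simp add: returns_def)
    have "(step ^^ n) (z, x, y) = (step ^^ (n mod k)) ((step ^^ (k * (n div k))) (z, x, y))"
      by (metis comp_apply funpow_add mod_mult_div_eq)
    then have nm: "(step ^^ n) (z, x, y) = (step ^^ (n mod k)) (z, x, y)"
      using funpow_fixed_mult[OF per] by simp
    have "n mod k < k" using k by simp
    then have "n mod k = 0" using *(1) that nm unfolding returns_def by (metis gr0I)
    then show ?thesis using nm by simp
  qed
  have "(x, y, z) \<in> flags" using xyz t by (simp add: flag_iff)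
  then have "same_zigzag (z, x, y) (x, y, z)" using kn flag_zxy(2) unfolding knotted_def by blast
  then obtain n where "(step ^^ n) (z, x, y) \<in> {(x, y, z), (z, y, x)}"
    unfolding same_zigzag_def reach_def by (metis flip.simps insertCI)
  moreover have "(x, y, z) \<in> flags_of t" "(z, y, x) \<in> flags_of t" using xyz by (auto simp: flags_of_def)
  ultimately show False using only[of n] d by auto
qed

end

lemma same_zigzag_step: "same_zigzag \<phi> (step \<phi>)"
  unfolding same_zigzag_def using reachI[of \<phi> 1] by simp

lemma knottedI:
  assumes local: "\<And>t \<phi> \<psi>. t \<in> T \<Longrightarrow> \<phi> \<in> flags_of t \<Longrightarrow> \<psi> \<in> flags_of t \<Longrightarrow> same_zigzag \<phi> \<psi>"
  shows knotted
  unfolding knotted_def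
proof (intro ballI)
  fix \<phi> \<psi> assume \<phi>: "\<phi> \<in> flags" and \<psi>: "\<psi> \<in> flags"
  let ?K = "{t \<in> T. \<forall>\<theta>\<in>flags_of t. same_zigzag \<phi> \<theta>}"
  have in_K: "t \<in> ?K" if "t \<in> T" "\<eta> \<in> flags_of t" "same_zigzag \<phi> \<eta>" for t \<eta>
    using that local same_zigzag_trans[OF \<phi>] flags_of_subset[OF that(1)] by blast
  have "?K = T"
  proof (rule strongly_connected)
    obtain x y z where "\<phi> = (x, y, z)" by (cases \<phi>)
    then have "\<phi> \<in> flags_of {x, y, z}" "{x, y, z} \<in> T" using \<phi> by (auto simp: flags_of_def flag_iff)
    then have "{x, y, z} \<in> ?K" using local by blast
    then show "?K \<noteq> {}" by blast
  next
    fix s t x y assume s: "s \<in> ?K" and t: "t \<in> T" and xy: "x \<noteq> y" "x \<in> s \<inter> t" "y \<in> s \<inter> t"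
    obtain u where u: "s = {x, y, u}" using triangle_eq[of s x y] s xy by blast
    obtain w where w: "t = {x, y, w}" using triangle_eq[of t x y] t xy by blast
    show "t \<in> ?K"
    proof (cases "u = w")
      case True
      then show ?thesis using u w s by simp
    next
      case False
      have ux: "(u, x, y) \<in> flags_of s" using u by (auto simp: flags_of_def)
      have xw: "(x, y, w) \<in> flags_of t" using w by (auto simp: flags_of_def)
      have fl: "(u, x, y) \<in> flags" "(x, y, w) \<in> flags"
        using ux xw flags_of_subset s t by blast+
      have "step (u, x, y) = (x, y, w)" using step_eqI[OF fl] False by simp
      then have "same_zigzag (u, x, y) (x, y, w)" using same_zigzag_step by metis
      moreover have "same_zigzag \<phi> (u, x, y)" using s ux by blast
      ultimately have "same_zigzag \<phi> (x, y, w)" using same_zigzag_trans[OF \<phi> fl(1)] by blast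
      then show ?thesis using in_K[OF t xw] by blast
    qed
  qed blast
  moreover obtain x y z where "\<psi> = (x, y, z)" by (cases \<psi>)
  then have "\<psi> \<in> flags_of {x, y, z}" "{x, y, z} \<in> T" using \<psi> by (auto simp: flags_of_def flag_iff)
  ultimately show "same_zigzag \<phi> \<psi>" by blast
qed

end

section \<open>The four types of z-monodromy\<close>

definition four_types :: "('a \<times> 'a) set \<Rightarrow> ('a \<times> 'a \<Rightarrow> 'a \<times> 'a) \<Rightarrow> ('a \<times> 'a \<Rightarrow> 'a \<times> 'a) \<Rightarrow> bool" where
  "four_types \<Omega> D M \<longleftrightarrow>
       (\<forall>e\<in>\<Omega>. M e = e) \<or>
       (\<forall>e\<in>\<Omega>. M e = D e) \<or>
       (\<exists>e1\<in>\<Omega>. \<exists>e2 e3. e2 = D e1 \<and> e3 = D e2 \<and>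
          (\<forall>e\<in>\<Omega>. M e =
             (cycle_of_list [prod.swap e1, e2, e3] \<circ>
              cycle_of_list [prod.swap e3, prod.swap e2, e1]) e)) \<or>
       (\<exists>e1\<in>\<Omega>. \<exists>e2 e3. e2 = D e1 \<and> e3 = D e2 \<and>
          (\<forall>e\<in>\<Omega>. M e =
             (cycle_of_list [e1, prod.swap e2] \<circ>
              cycle_of_list [e2, prod.swap e1]) e))"

text \<open>
  Here \<open>e \<mapsto> s (M e)\<close> is a fixed-point-free involution. Of the 15 perfect matchings of the six oriented
  edges, the excluded values \<open>M e\<close> with \<open>D (M e) = e\<close> leave the eight below.
\<close>

lemma monodromy_cases:
  fixes e1 e2 e3 n1 n2 n3 :: 'b
  assumes d: "distinct [e1,e2,e3,n1,n2,n3]"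
   and s: "s e1 = n1" "s e2 = n2" "s e3 = n3" "s n1 = e1" "s n2 = e2" "s n3 = e3"
   and v: "M e1 = e1 \<or> M e1 = e2 \<or> M e1 = n2 \<or> M e1 = n3"
   "M e2 = e2 \<or> M e2 = e3 \<or> M e2 = n1 \<or> M e2 = n3"
   "M e3 = e3 \<or> M e3 = e1 \<or> M e3 = n1 \<or> M e3 = n2"
   "M n1 = n1 \<or> M n1 = n3 \<or> M n1 = e2 \<or> M n1 = e3"
   "M n2 = n2 \<or> M n2 = n1 \<or> M n2 = e1 \<or> M n2 = e3"
   "M n3 = n3 \<or> M n3 = n2 \<or> M n3 = e1 \<or> M n3 = e2"
   and i: "M (s (M e1)) = s e1" "M (s (M e2)) = s e2" "M (s (M e3)) = s e3" "M (s (M n1)) = s n1" "M (s (M n2)) = s n2" "M (s (M n3)) = s n3"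
  shows "M e1 = e1 \<and> (M e2 = e2 \<and> M e3 = e3 \<and> M n1 = n1 \<and> M n2 = n2 \<and>
      M n3 = n3 \<or> M e2 = n3 \<and> M e3 = n2 \<and> M n1 = n1 \<and> M n2 = e3 \<and> M n3 = e2) \<or>
   M e1 = e2 \<and> (M e2 = n3 \<and> M e3 = n2 \<and> M n1 = e3 \<and> M n2 = n1 \<and> M n3 = e1 \<or>
      M e2 = e3 \<and> M e3 = e1 \<and> M n1 = n3 \<and> M n2 = n1 \<and> M n3 = n2) \<or>
   M e1 = n2 \<and> (M e2 = n1 \<and> M e3 = e1 \<and> M n1 = n3 \<and> M n2 = e3 \<and> M n3 = e2 \<or>
      M e2 = n1 \<and> M e3 = e3 \<and> M n1 = e2 \<and> M n2 = e1 \<and> M n3 = n3) \<or>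
   M e1 = n3 \<and> (M e2 = e2 \<and> M e3 = n1 \<and> M n1 = e3 \<and> M n2 = n2 \<and> M n3 = e1 \<or>
      M e2 = e3 \<and> M e3 = n1 \<and> M n1 = e2 \<and> M n2 = e1 \<and> M n3 = n2)"
  using assms by (smt (verit) distinct_length_2_or_more)

locale oriented_triangle =
  fixes a b c :: 'a and \<Omega> :: "('a \<times> 'a) set" and D :: "'a \<times> 'a \<Rightarrow> 'a \<times> 'a"
  assumes distinct: "a \<noteq> b" "b \<noteq> c" "a \<noteq> c"
    and Omega: "\<Omega> = {(a, b), (b, c), (c, a), (b, a), (c, b), (a, c)}"
    and rotation: "D (a, b) = (b, c)" "D (b, c) = (c, a)" "D (c, a) = (a, b)"
      "D (b, a) = (a, c)" "D (c, b) = (b, a)" "D (a, c) = (c, b)"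
begin

lemmas distinct' = distinct distinct[symmetric]

lemma four_types_iff: "four_types \<Omega> D M \<longleftrightarrow>
   (M (a, b) = (a, b) \<and> (M (b, c) = (b, c) \<and> M (c, a) = (c, a) \<and> M (b, a) = (b, a) \<and>
      M (c, b) = (c, b) \<and> M (a, c) = (a, c) \<or> M (b, c) = (a, c) \<and> M (c, a) = (c, b) \<and>
      M (b, a) = (b, a) \<and> M (c, b) = (c, a) \<and> M (a, c) = (b, c)) \<or>
   M (a, b) = (b, c) \<and> (M (b, c) = (a, c) \<and> M (c, a) = (c, b) \<and> M (b, a) = (c, a) \<and>
      M (c, b) = (b, a) \<and> M (a, c) = (a, b) \<or> M (b, c) = (c, a) \<and> M (c, a) = (a, b) \<and>
      M (b, a) = (a, c) \<and> M (c, b) = (b, a) \<and> M (a, c) = (c, b)) \<or>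
   M (a, b) = (c, b) \<and> (M (b, c) = (b, a) \<and> M (c, a) = (a, b) \<and> M (b, a) = (a, c) \<and>
      M (c, b) = (c, a) \<and> M (a, c) = (b, c) \<or> M (b, c) = (b, a) \<and> M (c, a) = (c, a) \<and>
      M (b, a) = (b, c) \<and> M (c, b) = (a, b) \<and> M (a, c) = (a, c)) \<or>
   M (a, b) = (a, c) \<and> (M (b, c) = (b, c) \<and> M (c, a) = (b, a) \<and> M (b, a) = (c, a) \<and>
      M (c, b) = (c, b) \<and> M (a, c) = (a, b) \<or> M (b, c) = (c, a) \<and> M (c, a) = (b, a) \<and>
      M (b, a) = (b, c) \<and> M (c, b) = (a, b) \<and> M (a, c) = (c, b)))" (is "_ \<longleftrightarrow> ?K")
proof
  assume "four_types \<Omega> D M"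
  then consider "\<forall>e\<in>\<Omega>. M e = e" | "\<forall>e\<in>\<Omega>. M e = D e"
    | e1 where "e1 \<in> \<Omega>" "\<forall>e\<in>\<Omega>. M e =
         (cycle_of_list [prod.swap e1, D e1, D (D e1)] \<circ>
          cycle_of_list [prod.swap (D (D e1)), prod.swap (D e1), e1]) e"
    | e1 where "e1 \<in> \<Omega>" "\<forall>e\<in>\<Omega>. M e =
         (cycle_of_list [e1, prod.swap (D e1)] \<circ> cycle_of_list [D e1, prod.swap e1]) e"
    unfolding four_types_def by blast
  then show ?K
  proof cases
    case 3
    then show ?thesis unfolding Omega
      by (elim insertE emptyE; simp add: rotation distinct' transpose_def)
  next
    case 4
    then show ?thesis unfolding Omega
      by (elim insertE emptyE; simp add: rotation distinct' transpose_def)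
  qed (simp_all add: Omega rotation distinct')
next
  assume ?K
  then show "four_types \<Omega> D M"
    unfolding four_types_def Omega
    by (elim disjE conjE; simp add: rotation distinct' transpose_def)
qed

lemma four_typesI:
  assumes range: "\<And>e. e \<in> \<Omega> \<Longrightarrow> M e \<in> \<Omega>"
    and swap: "\<And>e. e \<in> \<Omega> \<Longrightarrow> M (prod.swap (M e)) = prod.swap e"
    and neq: "\<And>e. e \<in> \<Omega> \<Longrightarrow> M e \<noteq> prod.swap e"
    and nofix: "\<And>e. e \<in> \<Omega> \<Longrightarrow> D (M e) \<noteq> e"
  shows "four_types \<Omega> D M"
proof -
  have vals: "M e \<in> \<Omega> - {prod.swap e, f}" if "e \<in> \<Omega>" "D f = e" for e f
    using range neq nofix that by blast
  have v1: "M (a, b) = (a, b) \<or> M (a, b) = (b, c) \<or> M (a, b) = (c, b) \<or> M (a, b) = (a, c)"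
    using vals[of "(a, b)" "(c, a)"] unfolding Omega rotation by auto
  have v2: "M (b, c) = (b, c) \<or> M (b, c) = (c, a) \<or> M (b, c) = (b, a) \<or> M (b, c) = (a, c)"
    using vals[of "(b, c)" "(a, b)"] unfolding Omega rotation by auto
  have v3: "M (c, a) = (c, a) \<or> M (c, a) = (a, b) \<or> M (c, a) = (b, a) \<or> M (c, a) = (c, b)"
    using vals[of "(c, a)" "(b, c)"] unfolding Omega rotation by auto
  have v4: "M (b, a) = (b, a) \<or> M (b, a) = (a, c) \<or> M (b, a) = (b, c) \<or> M (b, a) = (c, a)"
    using vals[of "(b, a)" "(c, b)"] unfolding Omega rotation by auto
  have v5: "M (c, b) = (c, b) \<or> M (c, b) = (b, a) \<or> M (c, b) = (a, b) \<or> M (c, b) = (c, a)"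
    using vals[of "(c, b)" "(a, c)"] unfolding Omega rotation by auto
  have v6: "M (a, c) = (a, c) \<or> M (a, c) = (c, b) \<or> M (a, c) = (a, b) \<or> M (a, c) = (b, c)"
    using vals[of "(a, c)" "(b, a)"] unfolding Omega rotation by auto
  show ?thesis
    unfolding four_types_iff
    by (rule monodromy_cases[where s = prod.swap, OF _ _ _ _ _ _ _ v1 v2 v3 v4 v5 v6])
      (simp_all add: distinct' swap[unfolded Omega])
qed

lemma connectedI:
  assumes M: "four_types \<Omega> D M"
    and refl: "\<And>e. e \<in> \<Omega> \<Longrightarrow> R e e"
    and sym: "\<And>e f. e \<in> \<Omega> \<Longrightarrow> f \<in> \<Omega> \<Longrightarrow> R e f \<Longrightarrow> R f e"
    and trans: "\<And>e f g. e \<in> \<Omega> \<Longrightarrow> f \<in> \<Omega> \<Longrightarrow> g \<in> \<Omega> \<Longrightarrow> R e f \<Longrightarrow> R f g \<Longrightarrow> R e g"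
    and step: "\<And>e. e \<in> \<Omega> \<Longrightarrow> R e (D (M e))"
    and flip: "R (a, b) (a, c)" "R (b, a) (b, c)" "R (c, a) (c, b)"
    and ef: "e \<in> \<Omega>" "f \<in> \<Omega>"
  shows "R e f"
proof -
  have mem: "(a, b) \<in> \<Omega>" "(b, c) \<in> \<Omega>" "(c, a) \<in> \<Omega>" "(b, a) \<in> \<Omega>" "(c, b) \<in> \<Omega>" "(a, c) \<in> \<Omega>"
    by (simp_all add: Omega)
  define p where "p g = R (a, b) g" for g
  have p_iff: "p g \<longleftrightarrow> p h" if "R g h" "g \<in> \<Omega>" "h \<in> \<Omega>" for g h
    unfolding p_def using that sym trans mem(1) by meson
  have DM: "\<forall>g\<in>\<Omega>. D (M g) \<in> \<Omega>"
    using M[unfolded four_types_iff] unfolding Omega by (elim disjE conjE; simp add: rotation)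
  have st: "p g \<longleftrightarrow> p (D (M g))" if "g \<in> \<Omega>" for g
    using p_iff[OF step[OF that] that] DM that by blast
  note st6 = st[OF mem(1)] st[OF mem(2)] st[OF mem(3)] st[OF mem(4)] st[OF mem(5)] st[OF mem(6)]
  have p0: "p (a, b)" using refl mem by (simp add: p_def)
  have fl: "p (a, b) = p (a, c)" "p (b, a) = p (b, c)" "p (c, a) = p (c, b)"
    using p_iff flip mem by blast+
  have "p (b, c) \<and> p (c, a) \<and> p (b, a) \<and> p (c, b) \<and> p (a, c)"
    using M[unfolded four_types_iff]
  proof (elim disjE conjE, goal_cases)
    case 1
    show ?case using p0 fl st6[unfolded 1 rotation] by blast
  next
    case 2
    show ?case using p0 fl st6[unfolded 2 rotation] by blast
  next
    case 3
    show ?case using p0 fl st6[unfolded 3 rotation] by blast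
  next
    case 4
    show ?case using p0 fl st6[unfolded 4 rotation] by blast
  next
    case 5
    show ?case using p0 fl st6[unfolded 5 rotation] by blast
  next
    case 6
    show ?case using p0 fl st6[unfolded 6 rotation] by blast
  next
    case 7
    show ?case using p0 fl st6[unfolded 7 rotation] by blast
  next
    case 8
    show ?case using p0 fl st6[unfolded 8 rotation] by blast
  qed
  then have "p e" "p f" using ef p0 unfolding Omega by auto
  then show ?thesis unfolding p_def using sym trans ef mem(1) by blast
qed

end

section \<open>Characterisation of z-knotted triangulations\<close>

context triangulation begin

abbreviation triangles :: "'a set set" where
  "triangles \<equiv> (\<lambda>F. verts G \<inter> F) ` faces G"

sublocale combinatorial: triangle_complex triangles
proof
  show "finite triangles" using finite_faces by simp
  show "card t = 3" if "t \<in> triangles" for t using that card_face_verts by blast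
  show "triangles \<noteq> {}" using faces_nonempty by simp
next
  fix t x y assume t: "t \<in> triangles" "x \<in> t" "y \<in> t" "x \<noteq> y"
  then obtain F where F: "F \<in> faces G" "t = verts G \<inter> F" by blast
  have e: "{x, y} \<in> face_edges G F" using face_edges_iff[OF F(1)] t F(2) by simp
  then have eG: "{x, y} \<in> edges G" by (simp add: face_edges_def)
  obtain A B where AB: "A \<noteq> B" "{F \<in> faces G. {x, y} \<in> face_edges G F} = {A, B}"
    using edge_two_faces[OF eG] by (auto simp: card_2_iff)
  have "F \<in> {A, B}" using F(1) e unfolding AB(2)[symmetric] by blast
  then obtain F' where F': "F' \<noteq> F" "{F \<in> faces G. {x, y} \<in> face_edges G F} = {F, F'}"
    using AB by (metis doubleton_eq_iff empty_iff insert_iff)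
  then have F'f: "F' \<in> faces G" "{x, y} \<in> face_edges G F'" by blast+
  show "\<exists>!s. s \<in> triangles \<and> s \<noteq> t \<and> x \<in> s \<and> y \<in> s"
  proof (rule ex1I[of _ "verts G \<inter> F'"])
    show "verts G \<inter> F' \<in> triangles \<and> verts G \<inter> F' \<noteq> t \<and> x \<in> verts G \<inter> F' \<and> y \<in> verts G \<inter> F'"
      using F'f F'(1) face_edges_iff[OF F'f(1), of x y] F inj_on_face_verts by (auto dest: inj_onD)
  next
    fix s assume s: "s \<in> triangles \<and> s \<noteq> t \<and> x \<in> s \<and> y \<in> s"
    then obtain F'' where F'': "F'' \<in> faces G" "s = verts G \<inter> F''" by blast
    then have "{x, y} \<in> face_edges G F''" using s t(4) face_edges_iff[OF F''(1)] by simp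
    then have "F'' \<in> {F, F'}" using F'' unfolding F'(2)[symmetric] by blast
    then show "s = verts G \<inter> F'" using s F F'' by auto
  qed
next
  fix K assume K: "K \<subseteq> triangles" "K \<noteq> {}"
    and adj: "\<And>s t x y. s \<in> K \<Longrightarrow> t \<in> triangles \<Longrightarrow> x \<noteq> y \<Longrightarrow> x \<in> s \<inter> t \<Longrightarrow> y \<in> s \<inter> t \<Longrightarrow> t \<in> K"
  let ?K = "{F \<in> faces G. verts G \<inter> F \<in> K}"
  have "?K = faces G"
  proof (rule strongly_connected)
    show "?K \<noteq> {}" using K by blast
    fix F F' e assume F: "F \<in> ?K" "F' \<in> faces G" "e \<in> face_edges G F" "e \<in> face_edges G F'"
    obtain x y where xy: "e = {x, y}" "x \<noteq> y" using F(3) edge_pair by (auto simp: face_edges_def)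
    have "verts G \<inter> F' \<in> K"
      using adj[of "verts G \<inter> F" "verts G \<inter> F'" x y] F xy face_edges_iff[of F x y] face_edges_iff[of F' x y] by blast
    then show "F' \<in> ?K" using F by simp
  qed blast
  then show "K = triangles" using K by blast
qed

lemma face_edges_triangle:
  assumes F: "F \<in> faces G" and "{x, y} \<in> face_edges G F" "{y, z} \<in> face_edges G F" "{x, y} \<noteq> {y, z}"
  shows "verts G \<inter> F = {x, y, z}"
proof -
  have *: "x \<noteq> y" "y \<noteq> z" "x \<noteq> z" "{x, y, z} \<subseteq> verts G \<inter> F"
    using assms(2-4) face_edges_iff[OF F] by (auto simp: insert_commute)
  then have "card {x, y, z} = card (verts G \<inter> F)" using card_face_verts[OF F] by simp
  then show ?thesis using * card_subset_eq[of "verts G \<inter> F" "{x, y, z}"] finite_verts by simp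
qed

lemma zigzag_iff: "zigzag G v \<longleftrightarrow> combinatorial.is_zigzag v"
proof
  assume v: "zigzag G v"
  show "combinatorial.is_zigzag v"
    unfolding combinatorial.is_zigzag_def
  proof
    fix i
    have ne: "{v i, v (Suc i)} \<noteq> {v (Suc i), v (Suc (Suc i))}"
      "{v (Suc i), v (Suc (Suc i))} \<noteq> {v (Suc (Suc i)), v (Suc (Suc (Suc i)))}"
      using v unfolding zigzag_def adjacent_def Let_def by blast+
    obtain F F' where F: "F \<in> faces G" "F' \<in> faces G" "F \<noteq> F'"
      "{v i, v (Suc i)} \<in> face_edges G F" "{v (Suc i), v (Suc (Suc i))} \<in> face_edges G F"
      "{v (Suc i), v (Suc (Suc i))} \<in> face_edges G F'"
      "{v (Suc (Suc i)), v (Suc (Suc (Suc i)))} \<in> face_edges G F'"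
      using v unfolding zigzag_def Let_def by blast
    have t: "verts G \<inter> F = {v i, v (Suc i), v (Suc (Suc i))}"
      using face_edges_triangle[OF F(1,4,5) ne(1)] .
    moreover have "verts G \<inter> F' = {v (Suc i), v (Suc (Suc i)), v (Suc (Suc (Suc i)))}"
      using face_edges_triangle[OF F(2,6,7) ne(2)] .
    moreover have "verts G \<inter> F \<noteq> verts G \<inter> F'" using inj_on_face_verts F by (auto dest: inj_onD)
    ultimately have "v (Suc (Suc (Suc i))) \<noteq> v i" by auto
    moreover have "{v i, v (Suc i), v (Suc (Suc i))} \<in> triangles" using t F(1) by blast
    ultimately show "{v i, v (Suc i), v (Suc (Suc i))} \<in> triangles \<and> v (Suc (Suc (Suc i))) \<noteq> v i" by blast
  qed
next
  assume v: "combinatorial.is_zigzag v"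
  show "zigzag G v"
    unfolding zigzag_def Let_def
  proof
    fix i
    have tri: "\<exists>F\<in>faces G. verts G \<inter> F = {v j, v (Suc j), v (Suc (Suc j))}" for j
      using v unfolding combinatorial.is_zigzag_def by (metis imageE)
    obtain F where F: "F \<in> faces G" "verts G \<inter> F = {v i, v (Suc i), v (Suc (Suc i))}" using tri by blast
    obtain F' where F': "F' \<in> faces G" "verts G \<inter> F' = {v (Suc i), v (Suc (Suc i)), v (Suc (Suc (Suc i)))}"
      using tri by blast
    have d: "v i \<noteq> v (Suc i)" "v (Suc i) \<noteq> v (Suc (Suc i))" "v i \<noteq> v (Suc (Suc i))"
      "v (Suc (Suc i)) \<noteq> v (Suc (Suc (Suc i)))" "v (Suc i) \<noteq> v (Suc (Suc (Suc i)))"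
      using v combinatorial.triangle_distinct unfolding combinatorial.is_zigzag_def by blast+
    have "v (Suc (Suc (Suc i))) \<noteq> v i" using v unfolding combinatorial.is_zigzag_def by blast
    then have "F \<noteq> F'" using F F' d by auto
    moreover have e: "{v i, v (Suc i)} \<in> face_edges G F" "{v (Suc i), v (Suc (Suc i))} \<in> face_edges G F"
      "{v (Suc i), v (Suc (Suc i))} \<in> face_edges G F'"
      "{v (Suc (Suc i)), v (Suc (Suc (Suc i)))} \<in> face_edges G F'"
      using F F' d by (simp_all add: face_edges_iff)
    moreover have "adjacent G {v i, v (Suc i)} {v (Suc i), v (Suc (Suc i))}"
      unfolding adjacent_def using e F(1) d by (auto simp: face_edges_def doubleton_eq_iff)
    ultimately show "adjacent G {v i, v (Suc i)} {v (Suc i), v (Suc (Suc i))} \<and>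
        (\<exists>F\<in>faces G. \<exists>F'\<in>faces G. F \<noteq> F' \<and> {v i, v (Suc i)} \<in> face_edges G F \<and>
          {v (Suc i), v (Suc (Suc i))} \<in> face_edges G F \<and>
          {v (Suc i), v (Suc (Suc i))} \<in> face_edges G F' \<and>
          {v (Suc (Suc i)), v (Suc (Suc (Suc i)))} \<in> face_edges G F')"
      using F(1) F'(1) by blast
  qed
qed

lemma z_knotted_iff: "z_knotted G \<longleftrightarrow> combinatorial.knotted"
  unfolding z_knotted_def zigzag_iff by (rule combinatorial.knotted_iff_cyclic_seq)

lemma oriented_edges_iff:
  "F \<in> faces G \<Longrightarrow> (x, y) \<in> oriented_edges G F \<longleftrightarrow> x \<noteq> y \<and> x \<in> verts G \<inter> F \<and> y \<in> verts G \<inter> F"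
  by (simp add: oriented_edges_def face_edges_iff)

lemma face_rotation_eq:
  assumes "verts G \<inter> F = {x, y, z}" "x \<noteq> z" "y \<noteq> z"
  shows "face_rotation G F (x, y) = (y, z)"
  using assms unfolding face_rotation_def by (auto intro!: the_equality)

lemma z_monodromy_is_monodromy:
  assumes F: "F \<in> faces G"
  shows "combinatorial.is_monodromy (verts G \<inter> F) (z_monodromy G F)"
  unfolding combinatorial.is_monodromy_def
proof (intro allI impI)
  fix x y z assume xyz: "{x, y, z} = verts G \<inter> F"
  have T: "verts G \<inter> F \<in> triangles" using F by blast
  have d: "x \<noteq> y" "y \<noteq> z" "x \<noteq> z" using combinatorial.triangle_distinct[of x y z] xyz T by auto
  have fl: "(z, x, y) \<in> combinatorial.flags"
    using T xyz by (simp add: combinatorial.flag_iff insert_commute)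
  let ?v = "combinatorial.zigzag_from (z, x, y)"
  have e0: "(THE e. e \<in> oriented_edges G F \<and> face_rotation G F e = (x, y)) = (z, x)"
  proof (rule the_equality)
    show "(z, x) \<in> oriented_edges G F \<and> face_rotation G F (z, x) = (x, y)"
      using xyz d by (auto simp: oriented_edges_iff[OF F] intro!: face_rotation_eq)
  next
    fix e assume e: "e \<in> oriented_edges G F \<and> face_rotation G F e = (x, y)"
    obtain u w where u: "e = (u, w)" by (cases e)
    then have w: "w = x" using e by (simp add: face_rotation_def)
    have "u \<in> {y, z}" using e u w xyz[symmetric] by (auto simp: oriented_edges_iff[OF F])
    moreover have "u \<noteq> y"
      using e u w face_rotation_eq[of F y x z] xyz d by (auto simp: insert_commute)
    ultimately show "e = (z, x)" using u w by simp
  qed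
  have v0: "(?v 0, ?v 1, ?v 2) = (z, x, y)"
    using combinatorial.funpow_zigzag_from[OF fl, of 0] by (simp add: numeral_2_eq_2)
  have v: "(THE v. zigzag G v \<and> (v 0, v 1) = (z, x) \<and> (v 1, v 2) = (x, y)) = ?v"
  proof (rule the_equality)
    show "zigzag G ?v \<and> (?v 0, ?v 1) = (z, x) \<and> (?v 1, ?v 2) = (x, y)"
      using combinatorial.is_zigzag_from[OF fl] v0 by (simp add: zigzag_iff)
  next
    fix v assume "zigzag G v \<and> (v 0, v 1) = (z, x) \<and> (v 1, v 2) = (x, y)"
    then show "v = ?v" using combinatorial.is_zigzag_eq(1)[of v] by (simp add: zigzag_iff)
  qed
  let ?n = "LEAST n. n > 1 \<and> ?v n \<in> verts G \<inter> F \<and> ?v (Suc n) \<in> verts G \<inter> F"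
  have ne: "?v n \<noteq> ?v (Suc n)" for n
    using combinatorial.is_zigzag_from[OF fl] combinatorial.triangle_distinct
    unfolding combinatorial.is_zigzag_def by blast
  have "z_monodromy G F (x, y) = (?v ?n, ?v (Suc ?n))"
    unfolding z_monodromy_def e0 v Let_def oriented_edges_iff[OF F] using ne by simp
  moreover obtain r where "combinatorial.returns (verts G \<inter> F) (z, x, y) ?n"
    "(combinatorial.step ^^ ?n) (z, x, y) = (?v ?n, ?v (Suc ?n), r)"
    using combinatorial.returns_exists[OF T xyz refl refl] by blast
  ultimately show "\<exists>k p q r. combinatorial.returns (verts G \<inter> F) (z, x, y) k \<and>
      (combinatorial.step ^^ k) (z, x, y) = (p, q, r) \<and> z_monodromy G F (x, y) = (p, q)"
    by blast
qed

lemma face_oriented_triangle: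
  assumes F: "F \<in> faces G" and abc: "verts G \<inter> F = {a, b, c}" "a \<noteq> b" "b \<noteq> c" "a \<noteq> c"
  shows "oriented_triangle a b c (oriented_edges G F) (face_rotation G F)"
proof
  show "a \<noteq> b" "b \<noteq> c" "a \<noteq> c" using abc by auto
  show "oriented_edges G F = {(a, b), (b, c), (c, a), (b, a), (c, b), (a, c)}"
    using abc(2-4) unfolding set_eq_iff split_paired_All oriented_edges_iff[OF F] abc(1) by auto
  show "face_rotation G F (a, b) = (b, c)" "face_rotation G F (b, c) = (c, a)"
    "face_rotation G F (c, a) = (a, b)" "face_rotation G F (b, a) = (a, c)"
    "face_rotation G F (c, b) = (b, a)" "face_rotation G F (a, c) = (c, b)"
    using abc by (auto intro: face_rotation_eq[of F a b c] face_rotation_eq[of F b c a]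
        face_rotation_eq[of F c a b] face_rotation_eq[of F b a c] face_rotation_eq[of F c b a]
        face_rotation_eq[of F a c b])
qed

lemma knotted_four_types:
  assumes kn: "combinatorial.knotted" and F: "F \<in> faces G"
  shows "four_types (oriented_edges G F) (face_rotation G F) (z_monodromy G F)"
proof -
  obtain a b c where abc: "a \<noteq> b" "b \<noteq> c" "a \<noteq> c" "verts G \<inter> F = {a, b, c}"
    using face_triangle[OF F] by metis
  interpret oriented_triangle a b c "oriented_edges G F" "face_rotation G F"
    using face_oriented_triangle[OF F abc(4,1,2,3)] .
  let ?t = "verts G \<inter> F"
  have T: "?t \<in> triangles" using F by blast
  note M = z_monodromy_is_monodromy[OF F]
  have ex: "\<exists>z. {fst e, snd e, z} = ?t \<and> fst e \<noteq> z \<and> snd e \<noteq> z" if "e \<in> oriented_edges G F" for e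
    using that combinatorial.triangle_eq[OF T, of "fst e" "snd e"] oriented_edges_iff[OF F, of "fst e" "snd e"] by auto
  show ?thesis
  proof (rule four_typesI)
    fix e assume e: "e \<in> oriented_edges G F"
    then obtain x y z where xyz: "e = (x, y)" "{x, y, z} = ?t" "x \<noteq> z" "y \<noteq> z"
      using ex by (metis prod.collapse)
    show "z_monodromy G F e \<in> oriented_edges G F"
      using combinatorial.monodromy_in[OF T M xyz(2)] xyz(1) oriented_edges_iff[OF F] by auto
    show "z_monodromy G F (prod.swap (z_monodromy G F e)) = prod.swap e"
      using combinatorial.monodromy_swap[OF T M xyz(2)] xyz(1) by simp
    show "z_monodromy G F e \<noteq> prod.swap e"
      using combinatorial.monodromy_neq_swap[OF T M xyz(2)] xyz(1) by simp
    show "face_rotation G F (z_monodromy G F e) \<noteq> e"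
    proof
      assume eq: "face_rotation G F (z_monodromy G F e) = e"
      obtain p q where pq: "z_monodromy G F (x, y) = (p, q)" "p \<noteq> q" "p \<in> ?t" "q \<in> ?t"
        using combinatorial.monodromy_in[OF T M xyz(2)] by blast
      have "q = x" using eq pq(1) xyz(1) by (simp add: face_rotation_def)
      moreover have "p \<noteq> y"
        using face_rotation_eq[of F y x z] eq pq(1) xyz \<open>q = x\<close> by (auto simp: insert_commute)
      ultimately have "z_monodromy G F (x, y) = (z, x)" using pq xyz(2)[symmetric] by auto
      then show False using combinatorial.knotted_monodromy_neq[OF T M xyz(2) kn] by blast
    qed
  qed
qed

lemma four_types_same_zigzag:
  assumes F: "F \<in> faces G"
    and types: "four_types (oriented_edges G F) (face_rotation G F) (z_monodromy G F)"
    and \<phi>: "\<phi> \<in> combinatorial.flags_of (verts G \<inter> F)" and \<psi>: "\<psi> \<in> combinatorial.flags_of (verts G \<inter> F)"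
  shows "combinatorial.same_zigzag \<phi> \<psi>"
proof -
  obtain a b c where abc: "a \<noteq> b" "b \<noteq> c" "a \<noteq> c" "verts G \<inter> F = {a, b, c}"
    using face_triangle[OF F] by metis
  interpret oriented_triangle a b c "oriented_edges G F" "face_rotation G F"
    using face_oriented_triangle[OF F abc(4,1,2,3)] .
  let ?t = "verts G \<inter> F" and ?D = "face_rotation G F" and ?M = "z_monodromy G F"
  have T: "?t \<in> triangles" using F by blast
  note M = z_monodromy_is_monodromy[OF F]
  define flag where "flag e = (snd (?D e), fst e, snd e)" for e
  have flag_eq: "flag (x, y) = (z, x, y)" if "{x, y, z} = ?t" for x y z
    using face_rotation_eq[of F x y z] combinatorial.triangle_distinct[of x y z] that T by (simp add: flag_def)
  have ex: "\<exists>x y z. e = (x, y) \<and> {x, y, z} = ?t" if "e \<in> oriented_edges G F" for e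
    using that combinatorial.triangle_eq[OF T, of "fst e" "snd e"] oriented_edges_iff[OF F, of "fst e" "snd e"]
    by (metis prod.collapse)
  have flags: "flag e \<in> combinatorial.flags" if e: "e \<in> oriented_edges G F" for e
    using ex[OF e] T flag_eq by (auto simp: combinatorial.flag_iff insert_commute)
  have R: "combinatorial.same_zigzag (flag e) (flag f)"
    if "e \<in> oriented_edges G F" "f \<in> oriented_edges G F" for e f
  proof (rule connectedI[OF types, where R = "\<lambda>e f. combinatorial.same_zigzag (flag e) (flag f)"])
    show "combinatorial.same_zigzag (flag e) (flag e)" for e
      by (simp add: combinatorial.same_zigzag_def combinatorial.reach_refl)
    show "combinatorial.same_zigzag (flag f) (flag e)"
      if "e \<in> oriented_edges G F" "f \<in> oriented_edges G F" "combinatorial.same_zigzag (flag e) (flag f)" for e f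
      using that combinatorial.same_zigzag_sym flags by blast
    show "combinatorial.same_zigzag (flag e) (flag g)"
      if "e \<in> oriented_edges G F" "f \<in> oriented_edges G F"
        "combinatorial.same_zigzag (flag e) (flag f)" "combinatorial.same_zigzag (flag f) (flag g)" for e f g
      using that combinatorial.same_zigzag_trans flags by blast
    show "combinatorial.same_zigzag (flag e) (flag (?D (?M e)))" if e: "e \<in> oriented_edges G F" for e
    proof -
      obtain x y z where xyz: "e = (x, y)" "{x, y, z} = ?t" using ex[OF e] by blast
      obtain p q where pq: "?M (x, y) = (p, q)" "p \<noteq> q" "p \<in> ?t" "q \<in> ?t"
        using combinatorial.monodromy_in[OF T M xyz(2)] by blast
      then obtain r where r: "{p, q, r} = ?t" "p \<noteq> r" "q \<noteq> r"
        using combinatorial.triangle_eq[OF T, of p q] by metis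
      have "{q, r, p} = ?t" using r by auto
      then have "flag (?D (?M e)) = (p, q, r)"
        using flag_eq[of q r p] face_rotation_eq[of F p q r] r pq xyz(1) by simp
      then show ?thesis
        using combinatorial.monodromy_same_zigzag[OF T M xyz(2) pq(1) r(1)] flag_eq[OF xyz(2)] xyz(1) by simp
    qed
    have fl: "combinatorial.same_zigzag (flag (x, y)) (flag (x, z))" if "{x, y, z} = ?t" for x y z
    proof -
      have "{x, z, y} = ?t" using that by auto
      then show ?thesis
        using flag_eq[of x y z] flag_eq[of x z y] that combinatorial.same_zigzag_flip[of "(z, x, y)"] by simp
    qed
    show "combinatorial.same_zigzag (flag (a, b)) (flag (a, c))"
      "combinatorial.same_zigzag (flag (b, a)) (flag (b, c))"
      "combinatorial.same_zigzag (flag (c, a)) (flag (c, b))"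
      using abc(4) by (auto intro!: fl)
  qed (rule that)+
  have "\<exists>e\<in>oriented_edges G F. \<theta> = flag e" if "\<theta> \<in> combinatorial.flags_of ?t" for \<theta>
  proof -
    obtain z x y where \<theta>: "\<theta> = (z, x, y)" by (cases \<theta>)
    then have xyz: "\<theta> = (z, x, y)" "{z, x, y} = ?t"
      using that by (simp_all add: combinatorial.flags_of_def)
    then have "{x, y, z} = ?t" by auto
    then have "\<theta> = flag (x, y)" "(x, y) \<in> oriented_edges G F"
      using flag_eq[of x y z] xyz(1) T combinatorial.triangle_distinct[of x y z] oriented_edges_iff[OF F, of x y] by auto
    then show ?thesis by blast
  qed
  then show ?thesis using R \<phi> \<psi> by metis
qed

lemma z_knotted_iff_four_types:
  "z_knotted G \<longleftrightarrow>
    (\<forall>F\<in>faces G. four_types (oriented_edges G F) (face_rotation G F) (z_monodromy G F))"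
proof
  assume "z_knotted G"
  then show "\<forall>F\<in>faces G. four_types (oriented_edges G F) (face_rotation G F) (z_monodromy G F)"
    using knotted_four_types z_knotted_iff by blast
next
  assume types: "\<forall>F\<in>faces G. four_types (oriented_edges G F) (face_rotation G F) (z_monodromy G F)"
  have "combinatorial.knotted"
  proof (rule combinatorial.knottedI)
    fix t \<phi> \<psi>
    assume t: "t \<in> triangles" "\<phi> \<in> combinatorial.flags_of t" "\<psi> \<in> combinatorial.flags_of t"
    then obtain F where "F \<in> faces G" "t = verts G \<inter> F" by blast
    then show "combinatorial.same_zigzag \<phi> \<psi>" using four_types_same_zigzag types t by blast
  qed
  then show "z_knotted G" using z_knotted_iff by blast
qed

end

theorem theorem3:
  fixes G :: "'a embedded_graph"
  assumes "surface_triangulation G"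
  shows "z_knotted G \<longleftrightarrow>
    (\<forall>F\<in>faces G.
       (\<forall>e\<in>oriented_edges G F. z_monodromy G F e = e) \<or>
       (\<forall>e\<in>oriented_edges G F. z_monodromy G F e = face_rotation G F e) \<or>
       (\<exists>e1\<in>oriented_edges G F. \<exists>e2 e3. e2 = face_rotation G F e1 \<and> e3 = face_rotation G F e2 \<and>
          (\<forall>e\<in>oriented_edges G F. z_monodromy G F e =
             (cycle_of_list [prod.swap e1, e2, e3] \<circ>
              cycle_of_list [prod.swap e3, prod.swap e2, e1]) e)) \<or>
       (\<exists>e1\<in>oriented_edges G F. \<exists>e2 e3. e2 = face_rotation G F e1 \<and> e3 = face_rotation G F e2 \<and>
          (\<forall>e\<in>oriented_edges G F. z_monodromy G F e =
             (cycle_of_list [e1, prod.swap e2] \<circ>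
              cycle_of_list [e2, prod.swap e1]) e)))"
proof -
  interpret triangulation G by (rule triangulation.intro[OF assms])
  show ?thesis using z_knotted_iff_four_types unfolding four_types_def .
qed

end
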